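(* Every $\mathcal W_2(4,5)$ set is a cousin of the set $\{\,i^kx^2+\sqrt{-2}\,xy+i^{-k}y^2 : k=0,1,2,3\,\}$, which satisfies $$\sum_{k=0}^3(-1)^k\left(i^kx^2+\sqrt{-2}\,xy+i^{-k}y^2\right)^5=0.$$
   Context: A set of nonzero complex binary forms of the same degree is honest if its elements are pairwise non-proportional. A $\mathcal W_2(r,d)$ set is an honest set $\{f_1,\dots,f_r\}$ of complex binary quadratic forms in $x,y$ such that $\{f_1^d,\dots,f_r^d\}$ is linearly dependent over $\mathbb C$. A linear change is an invertible change of variables $M:(x,y)\mapsto(\alpha x+\beta y,\gamma x+\delta y)$ over $\mathbb C$, and $(f\circ M)(x,y)=f(\alpha x+\beta y,\gamma x+\delta y)$. Two sets $\{f_1,\dots,f_r\}$ and $\{g_1,\dots,g_r\}$ are cousins if there are a permutation $\pi\in S_r$, nonzero constants $c_1,\dots,c_r\in\mathbb C$ and a linear change $M$ with $g_j=c_j(f_{\pi(j)}\circ M)$ for all $j$. *)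

theory Defs
  imports "HOL-Analysis.Analysis" "HOL-Computational_Algebra.Polynomial"
begin

text \<open>
  The ring of complex polynomials in \<open>x, y\<close> is represented as \<open>\<complex>[x][y]\<close>: the outer
  variable is \<open>y\<close>, and the coefficient of \<open>x\<^sup>i y\<^sup>j\<close> in \<open>f\<close> is \<open>coeff (coeff f j) i\<close>.
\<close>

type_synonym bipoly = "complex poly poly"

definition var_x :: bipoly where "var_x = [:[:0, 1:]:]"

definition var_y :: bipoly where "var_y = [:0, 1:]"

definition cscale :: "complex \<Rightarrow> bipoly \<Rightarrow> bipoly" where
  "cscale c f = smult [:c:] f"

global_interpretation bipoly: vector_space cscale
proof
  show "cscale a (cscale b f) = cscale (a * b) f" for a b f
    by (simp add: cscale_def mult.commute)
  show "cscale (a + b) f = cscale a f + cscale b f" for a b f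
    by (simp add: cscale_def flip: smult_add_left)
qed (simp_all add: cscale_def smult_add_right flip: one_pCons)

text \<open>The zero polynomial is a form of every degree.\<close>

definition binary_form :: "nat \<Rightarrow> bipoly \<Rightarrow> bool" where
  "binary_form n f \<longleftrightarrow> (\<forall>i j. coeff (coeff f j) i \<noteq> 0 \<longrightarrow> i + j = n)"

definition proportional :: "bipoly \<Rightarrow> bipoly \<Rightarrow> bool" where
  "proportional f g \<longleftrightarrow> (\<exists>c. c \<noteq> 0 \<and> f = cscale c g)"

definition honest :: "bipoly set \<Rightarrow> bool" where
  "honest F \<longleftrightarrow> (\<exists>n. \<forall>f\<in>F. binary_form n f \<and> f \<noteq> 0) \<and>
     pairwise (\<lambda>f g. \<not> proportional f g) F"

text \<open>
  Linear dependence is that of the vector space of bivariate polynomials over \<open>\<complex>\<close>.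
  For honest \<open>F\<close> and \<open>d > 0\<close> the map \<open>f \<mapsto> f\<^sup>d\<close> is injective on \<open>F\<close>, so dependence of
  the set of powers is the same as dependence of the family of powers.
\<close>

definition W2_set :: "nat \<Rightarrow> nat \<Rightarrow> bipoly set \<Rightarrow> bool" where
  "W2_set r d F \<longleftrightarrow> finite F \<and> card F = r \<and> honest F \<and>
     (\<forall>f\<in>F. binary_form 2 f) \<and> bipoly.dependent ((\<lambda>f. f ^ d) ` F)"

definition substitute :: "bipoly \<Rightarrow> bipoly \<Rightarrow> bipoly \<Rightarrow> bipoly" where
  "substitute f u v =
     (\<Sum>j\<le>degree f. \<Sum>i\<le>degree (coeff f j). cscale (coeff (coeff f j) i) (u ^ i * v ^ j))"

text \<open>
  The matrix with rows \<open>(\<alpha>, \<beta>)\<close> and \<open>(\<gamma>, \<delta>)\<close> stands for the change of variables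
  \<open>(x, y) \<mapsto> (\<alpha> x + \<beta> y, \<gamma> x + \<delta> y)\<close>.
\<close>

definition linear_change :: "bipoly \<Rightarrow> complex ^ 2 ^ 2 \<Rightarrow> bipoly" where
  "linear_change f M = substitute f
     (cscale (M $ 1 $ 1) var_x + cscale (M $ 1 $ 2) var_y)
     (cscale (M $ 2 $ 1) var_x + cscale (M $ 2 $ 2) var_y)"

definition cousins :: "nat \<Rightarrow> bipoly set \<Rightarrow> bipoly set \<Rightarrow> bool" where
  "cousins r F G \<longleftrightarrow> (\<exists>f g. bij_betw f {1..r} F \<and> bij_betw g {1..r} G \<and>
     (\<exists>\<pi> c M. \<pi> permutes {1..r} \<and> (\<forall>j\<in>{1..r}. c j \<noteq> 0) \<and> invertible M \<and>
       (\<forall>j\<in>{1..r}. g j = cscale (c j) (linear_change (f (\<pi> j)) M))))"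

text \<open>\<open>csqrt (-2)\<close> is the principal square root \<open>\<i> \<surd>2\<close>.\<close>

definition std_form :: "nat \<Rightarrow> bipoly" where
  "std_form k = cscale (\<i> ^ k) (var_x ^ 2) + cscale (csqrt (-2)) (var_x * var_y)
     + cscale (\<i> powi (- int k)) (var_y ^ 2)"

end

theory Submission
  imports Defs "HOL-Computational_Algebra.Fundamental_Theorem_Algebra"
begin

text \<open>
  Setting \<open>x = 1\<close> turns a quadratic form into a polynomial of degree at most \<open>2\<close>, and the space of
  these has dimension \<open>3\<close>.  So four forms \<open>p\<^sub>i\<close> with \<open>\<Sum> c\<^sub>i p\<^sub>i\<^sup>5 = 0\<close> also satisfy a linear relation
  \<open>\<Sum> d\<^sub>i p\<^sub>i = 0\<close>, in which \<open>\<plusminus>d\<^sub>i\<close> is the determinant of the other three forms.  All \<open>c\<^sub>i\<close> and \<open>d\<^sub>i\<close> are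
  nonzero.  For suppose that three of the forms lie in a pencil.  If the fourth does too, the
  relation is one between fifth powers of linear forms in two algebraically independent
  quantities, and these are independent (\<open>powers_in_pencil_independent\<close>).  If it does not, then the
  involution of the projective line attached to the pencil preserves the three forms and negates a
  component of the fourth, which therefore cannot enter the relation (\<open>outside_pencil_coefficient_zero\<close>).  Finally, three
  independent forms do not solve the Fermat equation (\<open>three_independent_quadratics_fermat\<close>).

  Put \<open>f\<^sub>i = d\<^sub>i p\<^sub>i\<close> and \<open>l\<^sub>i = c\<^sub>i / d\<^sub>i\<^sup>5\<close>, so that \<open>\<Sum> f\<^sub>i = 0\<close> and \<open>\<Sum> l\<^sub>i f\<^sub>i\<^sup>5 = 0\<close>.  Geometrically, the
  plane quintic \<open>\<Sum> l\<^sub>i X\<^sub>i\<^sup>5 = 0\<close> in the plane \<open>\<Sum> X\<^sub>i = 0\<close> contains the conic parametrised by the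
  \<open>f\<^sub>i\<close>.  The residual cubic meets this conic in six points, which are singular points of the quintic,
  that is, points where all \<open>l\<^sub>i X\<^sub>i\<^sup>4\<close> are equal; and as such a singular point is an ordinary node, the
  six points are distinct.  Algebraically the nodes are the zeros of a sextic \<open>h\<close>: the vector
  \<open>l\<^sub>i f\<^sub>i\<^sup>4 - l\<^sub>3 f\<^sub>3\<^sup>4\<close> (\<open>i < 3\<close>) is orthogonal to \<open>f\<^sub>i\<close> and to \<open>f\<^sub>i'\<close>, hence it is \<open>h\<close> times the vector of
  Wronskians (\<open>annihilator_of_tangent\<close>).  At most one node lies at infinity, so at least five are
  visible (\<open>five_nodes\<close>).

  At a node each quotient \<open>X\<^sub>i / X\<^sub>j\<close> is one of four numbers, so two of the five nodes agree in two of
  the four coordinates.  Comparing the other two coordinates forces \<open>l\<^sub>k / l\<^sub>m \<in> {1, -4, -1/4}\<close>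
  (\<open>coefficient_ratio\<close>).  Unequal values are excluded by arithmetic in the Gaussian integers
  and a count of nodes (\<open>coefficients_equal\<close>).  So \<open>\<Sum> f\<^sub>i = \<Sum> f\<^sub>i\<^sup>5 = 0\<close>.  When \<open>\<Sum> X\<^sub>i = 0\<close>, the power sum
  \<open>\<Sum> X\<^sub>i\<^sup>5\<close> is up to a constant the product of \<open>X\<^sub>0 + X\<^sub>1\<close>, \<open>X\<^sub>1 + X\<^sub>2\<close>, \<open>X\<^sub>2 + X\<^sub>0\<close> and \<open>\<Sum> X\<^sub>i\<^sup>2\<close>
  (\<open>quintic_power_sum_factorisation\<close>), and the first three do not vanish on the \<open>f\<^sub>i\<close>, as these are not
  proportional.  So \<open>\<Sum> f\<^sub>i\<^sup>2 = 0\<close>.  This determines the \<open>f\<^sub>i\<close> up to a linear change: in the discrete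
  Fourier coordinates \<open>f\<^sub>k = (-1)\<^sup>k (\<i>\<^sup>k A + B + \<i>\<^sup>-\<^sup>k C)\<close> the condition reads \<open>B\<^sup>2 = -2 A C\<close>, so that
  \<open>A = X\<^sup>2\<close>, \<open>C = Y\<^sup>2\<close> and \<open>B = \<surd>-2 X Y\<close> for linear forms \<open>X, Y\<close>.
\<close>

section \<open>Quadratic polynomials, Wronskians and determinants\<close>

lemma degree_le_2_eq:
  fixes p :: "'a::zero poly"
  assumes "degree p \<le> 2"
  shows "p = [:coeff p 0, coeff p 1, coeff p 2:]"
proof (rule poly_eqI)
  fix n
  consider "n = 0" | "n = 1" | "n = 2" | m where "n = Suc (Suc (Suc m))"
    by (metis One_nat_def Suc_1 not0_implies_Suc)
  then show "coeff p n = coeff [:coeff p 0, coeff p 1, coeff p 2:] n"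
    by cases (use assms in \<open>auto simp: numeral_2_eq_2 coeff_eq_0\<close>)
qed

definition wronskian :: "complex poly \<Rightarrow> complex poly \<Rightarrow> complex poly" where
  "wronskian p q = p * pderiv q - q * pderiv p"

lemma wronskian_combination:
  "wronskian (smult a p + smult b q) (smult c p + smult d q) = smult (a * d - b * c) (wronskian p q)"
  by (simp add: wronskian_def pderiv_add pderiv_smult algebra_simps smult_diff_left smult_diff_right)

lemma wronskian_quadratic:
  "wronskian [:a, b, c:] [:a', b', c':] = [:a * b' - a' * b, 2 * (a * c' - a' * c), b * c' - b' * c:]"
  by (simp add: wronskian_def pderiv_pCons algebra_simps)

lemma smult_sum_right: "smult c (\<Sum>i\<in>I. f i) = (\<Sum>i\<in>I. smult c (f i))"
  by (induction I rule: infinite_finite_induct) (simp_all add: smult_add_right)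

text \<open>
  If \<open>L\<^sub>i = \<alpha>\<^sub>i p + \<beta>\<^sub>i q\<close> and \<open>\<Sum> c\<^sub>i L\<^sub>i\<^sup>n\<^sup>+\<^sup>1 = 0\<close>, then also \<open>\<Sum> c\<^sub>i L\<^sub>i\<^sup>n L\<^sub>i' = 0\<close>.  Combining the two, with weights
  \<open>L\<^sub>k'\<close> and \<open>L\<^sub>k\<close>, gives \<open>\<Sum> c\<^sub>i L\<^sub>i\<^sup>n W(L\<^sub>i, L\<^sub>k) = 0\<close>, and every \<open>W(L\<^sub>i, L\<^sub>k)\<close> is a constant multiple of \<open>W(p, q)\<close>,
  which can be cancelled.  The term \<open>k\<close> has disappeared and the exponent has dropped by one.
\<close>

lemma powers_of_combinations_independent:
  fixes p q :: "complex poly"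
  assumes "wronskian p q \<noteq> 0" and "finite I" and "card I \<le> Suc n"
    and "\<And>i. i \<in> I \<Longrightarrow> (\<alpha> i, \<beta> i) \<noteq> (0, 0)"
    and "\<And>i j. i \<in> I \<Longrightarrow> j \<in> I \<Longrightarrow> i \<noteq> j \<Longrightarrow> \<alpha> i * \<beta> j \<noteq> \<alpha> j * \<beta> i"
    and "(\<Sum>i\<in>I. smult (c i) ((smult (\<alpha> i) p + smult (\<beta> i) q) ^ n)) = 0"
    and "i \<in> I"
  shows "c i = 0"
  using assms(2-)
proof (induction n arbitrary: I c i)
  case 0
  then have "I = {i}" by (metis One_nat_def card_le_Suc0_iff_eq is_singletonI' is_singleton_the_elem equals0D singletonD)
  with 0 show ?case by simp
next
  case (Suc n)
  define L where "L i = smult (\<alpha> i) p + smult (\<beta> i) q" for i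
  have sum: "(\<Sum>i\<in>I. smult (c i) (L i ^ Suc n)) = 0"
    using Suc.prems(5) by (simp only: L_def)
  show ?case
  proof (cases "I = {i}")
    case True
    have "L i \<noteq> 0"
    proof
      assume L0: "L i = 0"
      have "smult (\<alpha> i) (wronskian p q) = wronskian (L i) q" "smult (\<beta> i) (wronskian p q) = wronskian p (L i)"
        using wronskian_combination[of "\<alpha> i" p "\<beta> i" q 0 1] wronskian_combination[of 1 p 0 q "\<alpha> i" "\<beta> i"]
        by (simp_all add: L_def)
      with L0 assms(1) have "\<alpha> i = 0" "\<beta> i = 0" by (auto simp: wronskian_def)
      with Suc.prems(3,6) show False by auto
    qed
    with sum True show ?thesis by simp
  next
    case False
    then obtain k where k: "k \<in> I" "k \<noteq> i" using Suc.prems(6) by blast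
    have "pderiv (\<Sum>i\<in>I. smult (c i) (L i ^ Suc n)) = 0"
      by (simp only: sum pderiv_0)
    then have d: "(\<Sum>i\<in>I. smult (of_nat (Suc n) * c i) (L i ^ n * pderiv (L i))) = 0"
      by (simp only: higher_pderiv_sum[of 1, simplified] pderiv_smult pderiv_power_Suc mult_smult_left mult_smult_right smult_smult ac_simps)
    have "(\<Sum>i\<in>I. smult (c i) (L i ^ n * wronskian (L i) (L k)))
        = (\<Sum>i\<in>I. smult (c i) (L i ^ Suc n)) * pderiv (L k)
          - L k * (\<Sum>i\<in>I. smult (c i) (L i ^ n * pderiv (L i)))"
      by (simp add: wronskian_def sum_distrib_left sum_distrib_right sum_subtractf[symmetric] smult_diff_right algebra_simps)
    moreover have "(\<Sum>i\<in>I. smult (c i) (L i ^ n * pderiv (L i))) = 0"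
    proof -
      have "smult (of_nat (Suc n)) (\<Sum>i\<in>I. smult (c i) (L i ^ n * pderiv (L i))) = 0"
        unfolding d[symmetric] smult_sum_right by simp
      then show ?thesis by (simp only: smult_eq_0_iff of_nat_eq_0_iff) simp
    qed
    ultimately have "(\<Sum>i\<in>I. smult (c i) (L i ^ n * wronskian (L i) (L k))) = 0"
      by (simp only: sum) simp
    moreover have "wronskian (L i) (L k) = smult (\<alpha> i * \<beta> k - \<beta> i * \<alpha> k) (wronskian p q)" for i
      unfolding L_def by (rule wronskian_combination)
    ultimately have "wronskian p q * (\<Sum>i\<in>I. smult (c i * (\<alpha> i * \<beta> k - \<beta> i * \<alpha> k)) (L i ^ n)) = 0"
      by (simp add: sum_distrib_left algebra_simps)
    with assms(1) have "(\<Sum>i\<in>I. smult (c i * (\<alpha> i * \<beta> k - \<beta> i * \<alpha> k)) (L i ^ n)) = 0"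
      by simp
    then have "(\<Sum>i\<in>I - {k}. smult (c i * (\<alpha> i * \<beta> k - \<beta> i * \<alpha> k)) (L i ^ n)) = 0"
      using k Suc.prems(1) by (subst (asm) sum.remove[of I k]) (auto simp: mult.commute)
    then have "c i * (\<alpha> i * \<beta> k - \<beta> i * \<alpha> k) = 0"
      unfolding L_def
      by (intro Suc.IH[of "I - {k}"])
         (use Suc.prems k in \<open>auto simp: card_Diff_singleton\<close>)
    with Suc.prems(4)[of i k] k Suc.prems(6) show ?thesis by (simp add: mult.commute)
  qed
qed

definition det3 :: "complex poly \<Rightarrow> complex poly \<Rightarrow> complex poly \<Rightarrow> complex" where
  "det3 p q r =
     coeff p 0 * (coeff q 1 * coeff r 2 - coeff q 2 * coeff r 1)
   - coeff p 1 * (coeff q 0 * coeff r 2 - coeff q 2 * coeff r 0)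
   + coeff p 2 * (coeff q 0 * coeff r 1 - coeff q 1 * coeff r 0)"

text \<open>
  Cramer's rule: the linear relation between four vectors of a three-dimensional space.
\<close>

lemma det3_relation:
  assumes "degree p \<le> 2" "degree q \<le> 2" "degree r \<le> 2" "degree s \<le> 2"
  shows "smult (det3 q r s) p - smult (det3 p r s) q + smult (det3 p q s) r - smult (det3 p q r) s = 0"
proof -
  obtain p0 p1 p2 q0 q1 q2 r0 r1 r2 s0 s1 s2
    where "p = [:p0, p1, p2:]" "q = [:q0, q1, q2:]" "r = [:r0, r1, r2:]" "s = [:s0, s1, s2:]"
    using assms degree_le_2_eq by metis
  then show ?thesis
    by (simp add: det3_def numeral_2_eq_2 algebra_simps)
qed

text \<open>
  The form in which independence of three quadratics is used: a linear functional
  \<open>f \<mapsto> f\<^sub>0 u + f\<^sub>1 v + f\<^sub>2 w\<close> on quadratics that vanishes on a basis is zero.  Evaluation at a point,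
  the derivative at a point, and comparison of leading coefficients all have this shape.
\<close>

lemma det3_kernel:
  assumes "det3 p q r \<noteq> 0"
    and "\<And>f. f \<in> {p, q, r} \<Longrightarrow> coeff f 0 * u + coeff f 1 * v + coeff f 2 * w = 0"
  shows "u = 0" "v = 0" "w = 0"
proof -
  have e: "coeff p 0 * u + coeff p 1 * v + coeff p 2 * w = 0"
     "coeff q 0 * u + coeff q 1 * v + coeff q 2 * w = 0"
     "coeff r 0 * u + coeff r 1 * v + coeff r 2 * w = 0"
    using assms(2) by blast+
  have "det3 p q r * u = 0" "det3 p q r * v = 0" "det3 p q r * w = 0"
    using e unfolding det3_def by algebra+
  with assms(1) show "u = 0" "v = 0" "w = 0" by auto
qed

lemma det3_eq_0_imp_combination:
  assumes "degree p \<le> 2" "degree q \<le> 2" "degree r \<le> 2" "wronskian p q \<noteq> 0" "det3 p q r = 0"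
  obtains a b where "r = smult a p + smult b q"
proof -
  obtain p0 p1 p2 q0 q1 q2 r0 r1 r2
    where p: "p = [:p0, p1, p2:]" and q: "q = [:q0, q1, q2:]" and r: "r = [:r0, r1, r2:]"
    using assms(1-3) degree_le_2_eq by blast
  have det: "p0 * (q1 * r2 - q2 * r1) - p1 * (q0 * r2 - q2 * r0) + p2 * (q0 * r1 - q1 * r0) = 0"
    using assms(5) by (simp add: det3_def p q r numeral_2_eq_2)
  note witness = that
  have *: thesis if "d \<noteq> 0" "smult d r = smult a p + smult b q" for d a b
  proof (rule witness)
    have "r = smult (inverse d) (smult d r)" using \<open>d \<noteq> 0\<close> by simp
    also have "\<dots> = smult (inverse d * a) p + smult (inverse d * b) q"
      unfolding \<open>smult d r = _\<close> by (simp add: smult_add_right)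
    finally show "r = smult (inverse d * a) p + smult (inverse d * b) q" .
  qed
  have "p0 * q1 - q0 * p1 \<noteq> 0 \<or> p0 * q2 - q0 * p2 \<noteq> 0 \<or> p1 * q2 - q1 * p2 \<noteq> 0"
    using assms(4) unfolding p q wronskian_quadratic by auto
  then show thesis
  proof (elim disjE)
    assume "p0 * q1 - q0 * p1 \<noteq> 0"
    then show thesis
      by (rule *[where a = "r0 * q1 - r1 * q0" and b = "p0 * r1 - p1 * r0"])
         (use det in \<open>simp add: p q r algebra_simps\<close>)
  next
    assume "p0 * q2 - q0 * p2 \<noteq> 0"
    then show thesis
      by (rule *[where a = "r0 * q2 - r2 * q0" and b = "p0 * r2 - p2 * r0"])
         (use det in \<open>simp add: p q r algebra_simps\<close>)
  next
    assume "p1 * q2 - q1 * p2 \<noteq> 0"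
    then show thesis
      by (rule *[where a = "r1 * q2 - r2 * q1" and b = "p1 * r2 - p2 * r1"])
         (use det in \<open>simp add: p q r algebra_simps\<close>)
  qed
qed

section \<open>Vectors orthogonal to a conic and its tangent\<close>

text \<open>
  Over the field of rational functions the vectors orthogonal to \<open>(p, q, r)\<close> and \<open>(p', q', r')\<close> form a
  line, spanned by the cross product, whose entries are Wronskians.  That the factor \<open>h\<close> is a
  polynomial, with the expected bound on its degree, becomes visible in the basis \<open>1, X, X\<^sup>2\<close> of the
  quadratics, where the cross product is \<open>(X\<^sup>2, -2 X, 1)\<close>: there \<open>h\<close> is the last coordinate of the vector,
  and the first one is \<open>X\<^sup>2 h\<close>.
\<close>

lemma annihilator_of_tangent:
  assumes deg: "degree p \<le> 2" "degree q \<le> 2" "degree r \<le> 2"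
    and det: "det3 p q r \<noteq> 0"
    and rel: "u * p + v * q + w * r = 0"
    and rel': "u * pderiv p + v * pderiv q + w * pderiv r = 0"
  obtains h where
    "smult (det3 p q r) u = h * wronskian q r"
    "smult (det3 p q r) v = h * wronskian r p"
    "smult (det3 p q r) w = h * wronskian p q"
    "\<And>n. degree u \<le> n + 2 \<Longrightarrow> degree v \<le> n + 2 \<Longrightarrow> degree w \<le> n + 2 \<Longrightarrow> degree h \<le> n"
proof -
  obtain p0 p1 p2 q0 q1 q2 r0 r1 r2
    where p: "p = [:p0, p1, p2:]" and q: "q = [:q0, q1, q2:]" and r: "r = [:r0, r1, r2:]"
    using deg degree_le_2_eq by metis
  define X :: "complex poly" where "X = [:0, 1:]"
  define V0 where "V0 = smult p0 u + smult q0 v + smult r0 w"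
  define V1 where "V1 = smult p1 u + smult q1 v + smult r1 w"
  define h where "h = smult p2 u + smult q2 v + smult r2 w"
  have quad: "[:a, b, c:] = [:a:] + [:b:] * X + [:c:] * X\<^sup>2" for a b c
    by (simp add: X_def power2_eq_square)
  have sm: "smult a f = [:a:] * f" for a :: complex and f
    by simp
  have d: "pderiv [:a, b, c:] = [:b:] + 2 * [:c:] * X" for a b c
    by (simp add: X_def pderiv_pCons numeral_poly)
  have e0: "V0 + X * V1 + X\<^sup>2 * h = 0"
    using rel unfolding V0_def V1_def h_def p q r quad sm by algebra
  have e1: "V1 = - 2 * X * h"
    using rel' unfolding V1_def h_def p q r d sm by algebra
  have e2: "V0 = X\<^sup>2 * h"
    using e0 e1 by algebra
  have det3_val: "det3 p q r = p0 * (q1 * r2 - q2 * r1) - p1 * (q0 * r2 - q2 * r0) + p2 * (q0 * r1 - q1 * r0)"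
    by (simp add: det3_def p q r numeral_2_eq_2)
  \<comment> \<open>Cofactors recover \<open>u, v, w\<close> from their coordinates \<open>V0, V1, h\<close> in the basis of monomials.\<close>
  have cof: "smult (p0 * (q1 * r2 - q2 * r1) - p1 * (q0 * r2 - q2 * r0) + p2 * (q0 * r1 - q1 * r0)) u = 
      smult (q1 * r2 - q2 * r1) V0 - smult (q0 * r2 - q2 * r0) V1 + smult (q0 * r1 - q1 * r0) h"
     "smult (p0 * (q1 * r2 - q2 * r1) - p1 * (q0 * r2 - q2 * r0) + p2 * (q0 * r1 - q1 * r0)) v = 
      smult (r1 * p2 - r2 * p1) V0 - smult (r0 * p2 - r2 * p0) V1 + smult (r0 * p1 - r1 * p0) h"
     "smult (p0 * (q1 * r2 - q2 * r1) - p1 * (q0 * r2 - q2 * r0) + p2 * (q0 * r1 - q1 * r0)) w = 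
      smult (p1 * q2 - p2 * q1) V0 - smult (p0 * q2 - p2 * q0) V1 + smult (p0 * q1 - p1 * q0) h"
    unfolding V0_def V1_def h_def
    by (simp_all add: poly_eq_iff algebra_simps)
  have W: "wronskian [:a, b, c:] [:a', b', c':] * h =
      smult (b * c' - c * b') (X\<^sup>2 * h) - smult (a * c' - c * a') (- 2 * X * h) + smult (a * b' - b * a') h"
    for a b c a' b' c'
    unfolding wronskian_quadratic
    by (simp add: X_def poly_eq_poly_eq_iff[symmetric] fun_eq_iff power2_eq_square algebra_simps)
  show thesis
  proof (rule that)
    show "smult (det3 p q r) u = h * wronskian q r" "smult (det3 p q r) v = h * wronskian r p"
      "smult (det3 p q r) w = h * wronskian p q"
      by (subst det3_val, subst cof, simp only: e1 e2 p q r W mult.commute[of h])+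
    show "degree h \<le> n" if "degree u \<le> n + 2" "degree v \<le> n + 2" "degree w \<le> n + 2" for n
    proof (cases "h = 0")
      case False
      have "degree V0 \<le> n + 2" unfolding V0_def
        by (intro degree_add_le order.trans[OF degree_smult_le] that)
      moreover have "degree V0 = 2 + degree h"
        unfolding e2 using False by (subst degree_mult_eq) (auto simp: X_def power2_eq_square)
      ultimately show ?thesis by simp
    qed simp
  qed
qed

lemma det3_no_common_root:
  assumes "degree p \<le> 2" "degree q \<le> 2" "degree r \<le> 2" "det3 p q r \<noteq> 0"
  shows "poly p t \<noteq> 0 \<or> poly q t \<noteq> 0 \<or> poly r t \<noteq> 0"
proof (rule ccontr)
  assume "\<not> ?thesis"
  then have "coeff f 0 * 1 + coeff f 1 * t + coeff f 2 * t\<^sup>2 = 0" if "f \<in> {p, q, r}" for f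
    using that assms(1-3) by (subst (asm) (1 2 3) degree_le_2_eq) (auto simp: algebra_simps power2_eq_square)
  from det3_kernel(1)[OF assms(4) this] show False by simp
qed

lemma wronskian_degree_le:
  assumes "degree p \<le> 2" "degree q \<le> 2"
  shows "degree (wronskian p q) \<le> 2"
proof -
  obtain p0 p1 p2 q0 q1 q2 where "p = [:p0, p1, p2:]" "q = [:q0, q1, q2:]"
    using assms degree_le_2_eq by metis
  then show ?thesis by (simp add: wronskian_quadratic)
qed

lemma det3_wronskian:
  "det3 p q r \<noteq> 0 \<Longrightarrow> degree p \<le> 2 \<Longrightarrow> degree q \<le> 2 \<Longrightarrow> wronskian p q \<noteq> 0"
proof
  assume a: "det3 p q r \<noteq> 0" "degree p \<le> 2" "degree q \<le> 2" "wronskian p q = 0"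
  obtain p0 p1 p2 q0 q1 q2 where pq: "p = [:p0, p1, p2:]" "q = [:q0, q1, q2:]"
    using a(2,3) degree_le_2_eq by metis
  have "p0 * q1 - q0 * p1 = 0" "p0 * q2 - q0 * p2 = 0" "p1 * q2 - q1 * p2 = 0"
    using a(4) unfolding pq wronskian_quadratic by auto
  moreover have "det3 p q r = (p0 * q1 - q0 * p1) * coeff r 2 - (p0 * q2 - q0 * p2) * coeff r 1 + (p1 * q2 - q1 * p2) * coeff r 0"
    by (simp add: det3_def pq numeral_2_eq_2 algebra_simps)
  ultimately show False using a(1) by simp
qed

lemma det3_rotate: "det3 q r p = det3 p q r"
  by (simp add: det3_def algebra_simps)

text \<open>
  Here the orthogonal vector is \<open>(a p\<^sup>4, b q\<^sup>4, c r\<^sup>4)\<close>.  If one coefficient is nonzero,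
  then \<open>h\<close> is nonzero and so are all three coefficients.  At a zero of \<open>h\<close> all three quadratics would
  vanish, so \<open>h\<close> is constant.  Then the fourth powers are constant multiples of Wronskians, which have
  degree at most \<open>2\<close>, so \<open>p\<close>, \<open>q\<close>, \<open>r\<close> are constant and not independent.
\<close>

lemma three_independent_quadratics_fermat:
  assumes deg: "degree p \<le> 2" "degree q \<le> 2" "degree r \<le> 2"
    and det: "det3 p q r \<noteq> 0"
    and rel: "smult a (p ^ 5) + smult b (q ^ 5) + smult c (r ^ 5) = 0"
  shows "a = 0 \<and> b = 0 \<and> c = 0"
proof -
  have "pderiv (smult a (p ^ 5) + smult b (q ^ 5) + smult c (r ^ 5)) = 0"
    by (simp add: rel)
  then have "smult 5 (smult a (p ^ 4) * pderiv p + smult b (q ^ 4) * pderiv q + smult c (r ^ 4) * pderiv r) = 0"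
    by (simp add: pderiv_add pderiv_smult pderiv_power smult_add_right algebra_simps)
  then have rel': "smult a (p ^ 4) * pderiv p + smult b (q ^ 4) * pderiv q + smult c (r ^ 4) * pderiv r = 0"
    by (simp only: smult_eq_0_iff) simp
  have "smult a (p ^ 4) * p + smult b (q ^ 4) * q + smult c (r ^ 4) * r = 0"
    using rel by (simp add: eval_nat_numeral mult_ac)
  from annihilator_of_tangent[OF deg det this rel'] obtain h where
    h: "smult (det3 p q r) (smult a (p ^ 4)) = h * wronskian q r"
       "smult (det3 p q r) (smult b (q ^ 4)) = h * wronskian r p"
       "smult (det3 p q r) (smult c (r ^ 4)) = h * wronskian p q"
    by metis
  have W: "wronskian q r \<noteq> 0" "wronskian r p \<noteq> 0" "wronskian p q \<noteq> 0"
    using det3_wronskian[of q r p] det3_wronskian[of r p q] det3_wronskian[of p q r] det deg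
    by (simp_all add: det3_rotate)
  have nz: "p \<noteq> 0" "q \<noteq> 0" "r \<noteq> 0"
    using W by (auto simp: wronskian_def)
  show ?thesis
  proof (cases "h = 0")
    case True
    with h det nz show ?thesis by simp
  next
    case False
    with h W det have abc: "a \<noteq> 0" "b \<noteq> 0" "c \<noteq> 0"
      by auto
    have "poly h t \<noteq> 0" for t
    proof
      assume "poly h t = 0"
      with h have "poly (smult (det3 p q r) (smult a (p ^ 4))) t = 0"
        "poly (smult (det3 p q r) (smult b (q ^ 4))) t = 0"
        "poly (smult (det3 p q r) (smult c (r ^ 4))) t = 0"
        by simp_all
      with abc det have "poly p t = 0" "poly q t = 0" "poly r t = 0" by simp_all
      with det3_no_common_root[OF deg det] show False by blast
    qed
    then have "degree h = 0"
      using fundamental_theorem_of_algebra[of h] by (auto simp: constant_degree)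
    have small: "degree f = 0"
      if "smult (det3 p q r) (smult k (f ^ 4)) = h * w" "k \<noteq> 0" "degree w \<le> 2" for k f w
    proof -
      have "4 * degree f = degree (smult (det3 p q r) (smult k (f ^ 4)))"
        using det that(2) by (cases "f = 0") (simp_all add: degree_power_eq)
      also have "\<dots> \<le> degree h + degree w" unfolding that(1) by (rule degree_mult_le)
      finally show ?thesis using that(3) \<open>degree h = 0\<close> by simp
    qed
    have "degree p = 0" "degree q = 0"  "degree r = 0"
      using small[OF h(1) abc(1)] small[OF h(2) abc(2)] small[OF h(3) abc(3)]
        wronskian_degree_le deg by auto
    then have "det3 p q r = 0" by (simp add: det3_def coeff_eq_0)
    with det show ?thesis by simp
  qed
qed

section \<open>Nodes of the quintic on the conic\<close>

lemma sum_lessThan_4: "sum f {..<4::nat} = f 0 + f 1 + f 2 + f 3"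
  by (simp add: eval_nat_numeral add.assoc)

text \<open>
  The two top coefficients of a fourth power are its value and derivative at infinity.
\<close>

lemma top_coeffs: "coeff ([:a, b, c::complex:] ^ 4) 8 = c ^ 4" "coeff ([:a, b, c:] ^ 4) 7 = 4 * (c ^ 3 * b)"
proof -
  have sq: "[:a, b, c:]\<^sup>2 = [:a * a, 2 * a * b, 2 * a * c + b * b, 2 * b * c, c * c:]"
    by (simp add: power2_eq_square algebra_simps)
  have e: "[:a, b, c:] ^ 4 = [:a * a, 2 * a * b, 2 * a * c + b * b, 2 * b * c, c * c:] * [:a * a, 2 * a * b, 2 * a * c + b * b, 2 * b * c, c * c:]"
    unfolding sq[symmetric] by (subst power_add[symmetric]) simp
  have n: "8 = Suc (Suc (Suc (Suc (Suc (Suc (Suc (Suc 0)))))))" "7 = Suc (Suc (Suc (Suc (Suc (Suc (Suc 0))))))"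
    by simp_all
  show "coeff ([:a, b, c::complex:] ^ 4) 8 = c ^ 4" "coeff ([:a, b, c:] ^ 4) 7 = 4 * (c ^ 3 * b)"
    unfolding e n mult_pCons_left coeff_add coeff_smult coeff_pCons_Suc coeff_pCons_0 coeff_0 mult_zero_left
    by (simp_all add: power4_eq_xxxx power3_eq_cube)
qed
text \<open>
  The nodes are the roots of the factor \<open>h\<close> from \<open>annihilator_of_tangent\<close>, applied to the
  differences \<open>w\<^sub>i = l\<^sub>i p\<^sub>i\<^sup>4 - l\<^sub>3 p\<^sub>3\<^sup>4\<close>.  At a multiple root the \<open>w\<^sub>i\<close> vanish together with their derivatives,
  so the logarithmic derivatives \<open>p\<^sub>i' / p\<^sub>i\<close> agree; but then \<open>p\<^sub>i' - \<nu> p\<^sub>i\<close> vanishes there for all \<open>i\<close> with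
  the same \<open>\<nu>\<close>, which contradicts independence.  The same argument at infinity shows that \<open>h\<close>, of
  degree \<open>6\<close> as a form, has degree at least \<open>5\<close> as a polynomial.
\<close>

lemma five_nodes:
  fixes p :: "nat \<Rightarrow> complex poly" and l :: "nat \<Rightarrow> complex"
  assumes deg: "\<And>i. i < 4 \<Longrightarrow> degree (p i) \<le> 2"
    and det: "det3 (p 0) (p 1) (p 2) \<noteq> 0"
    and l: "\<And>i. i < 4 \<Longrightarrow> l i \<noteq> 0"
    and lin: "(\<Sum>i<4. p i) = 0"
    and quint: "(\<Sum>i<4. smult (l i) (p i ^ 5)) = 0"
  obtains T where "card T \<ge> 5"
    "\<And>t. t \<in> T \<Longrightarrow> \<exists>\<mu>. \<mu> \<noteq> 0 \<and> (\<forall>i<4. l i * poly (p i) t ^ 4 = \<mu>)"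
proof -
  define w where "w i = smult (l i) (p i ^ 4) - smult (l 3) (p 3 ^ 4)" for i
  have deg': "degree (p 0) \<le> 2" "degree (p 1) \<le> 2" "degree (p 2) \<le> 2"
    using deg by simp_all
  have rel: "w 0 * p 0 + w 1 * p 1 + w 2 * p 2 = 0"
  proof -
    have "f ^ 5 = f ^ 4 * f" for f :: "complex poly"
      by (simp add: eval_nat_numeral mult_ac)
    then have "w 0 * p 0 + w 1 * p 1 + w 2 * p 2 = (\<Sum>i<4. smult (l i) (p i ^ 5))
       - smult (l 3) (p 3 ^ 4) * (\<Sum>i<4. p i)"
      by (simp add: w_def sum_lessThan_4 smult_add_right algebra_simps)
    then show ?thesis by (simp add: lin quint)
  qed
  have dquint: "(\<Sum>i<4. smult (l i) (p i ^ 4 * pderiv (p i))) = 0"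
  proof -
    have "smult 5 (\<Sum>i<4. smult (l i) (p i ^ 4 * pderiv (p i))) = pderiv (\<Sum>i<4. smult (l i) (p i ^ 5))"
      by (simp add: sum_lessThan_4 pderiv_add pderiv_smult pderiv_power smult_add_right algebra_simps)
    then have "smult 5 (\<Sum>i<4. smult (l i) (p i ^ 4 * pderiv (p i))) = 0"
      by (simp only: quint pderiv_0)
    then show ?thesis by (simp only: smult_eq_0_iff) simp
  qed
  have dlin: "(\<Sum>i<4. pderiv (p i)) = 0"
  proof -
    have "(\<Sum>i<4. pderiv (p i)) = pderiv (\<Sum>i<4. p i)" by (simp add: sum_lessThan_4 pderiv_add)
    then show ?thesis by (simp only: lin pderiv_0)
  qed
  have rel': "w 0 * pderiv (p 0) + w 1 * pderiv (p 1) + w 2 * pderiv (p 2) = 0"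
  proof -
    have "w 0 * pderiv (p 0) + w 1 * pderiv (p 1) + w 2 * pderiv (p 2)
       = (\<Sum>i<4. smult (l i) (p i ^ 4 * pderiv (p i))) - smult (l 3) (p 3 ^ 4) * (\<Sum>i<4. pderiv (p i))"
      by (simp add: w_def sum_lessThan_4 smult_add_right algebra_simps)
    then show ?thesis by (simp only: dlin dquint) simp
  qed
  obtain h where
    h: "smult (det3 (p 0) (p 1) (p 2)) (w 0) = h * wronskian (p 1) (p 2)"
       "smult (det3 (p 0) (p 1) (p 2)) (w 1) = h * wronskian (p 2) (p 0)"
       "smult (det3 (p 0) (p 1) (p 2)) (w 2) = h * wronskian (p 0) (p 1)"
    using annihilator_of_tangent[OF deg' det rel rel'] by metis
  define D where "D = det3 (p 0) (p 1) (p 2)"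
  have h': "\<exists>g. smult D (w i) = h * g \<and> degree g \<le> 2" if "i < 3" for i
  proof -
    have "i = 0 \<or> i = 1 \<or> i = 2" using that by auto
    then show ?thesis using h wronskian_degree_le deg' unfolding D_def by metis
  qed
  have kernel: "u = 0 \<and> v = 0 \<and> z = 0"
    if kernel_eq: "\<And>i. i < 4 \<Longrightarrow> coeff (p i) 0 * u + coeff (p i) 1 * v + coeff (p i) 2 * z = 0" for u v z
  proof -
    have "coeff f 0 * u + coeff f 1 * v + coeff f 2 * z = 0" if "f \<in> {p 0, p 1, p 2}" for f
      using that kernel_eq[of 0] kernel_eq[of 1]
        kernel_eq[of 2] by auto
    from det3_kernel[OF det this] show ?thesis by blast
  qed
  have val: "poly (p i) t = coeff (p i) 0 * 1 + coeff (p i) 1 * t + coeff (p i) 2 * t\<^sup>2"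
    "poly (pderiv (p i)) t = coeff (p i) 0 * 0 + coeff (p i) 1 * 1 + coeff (p i) 2 * (2 * t)"
    if "i < 4" for i t
    by (subst degree_le_2_eq[OF deg[OF that]], simp add: power2_eq_square pderiv_pCons algebra_simps)+
  have node: "\<exists>\<mu>. \<mu> \<noteq> 0 \<and> (\<forall>i<4. l i * poly (p i) t ^ 4 = \<mu>)" if "poly h t = 0" for t
  proof -
    have eq: "l i * poly (p i) t ^ 4 = l 3 * poly (p 3) t ^ 4" if "i < 4" for i
    proof (cases "i = 3")
      case False
      with that h'[of i] obtain g where "smult D (w i) = h * g" by auto
      then have "poly (smult D (w i)) t = 0" using \<open>poly h t = 0\<close> by simp
      then show ?thesis using det by (simp add: D_def w_def)
    qed simp
    have "l 3 * poly (p 3) t ^ 4 \<noteq> 0"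
    proof
      assume "l 3 * poly (p 3) t ^ 4 = 0"
      with eq l have "poly (p i) t = 0" if "i < 4" for i
        using that by fastforce
      then have "(1::complex) = 0"
        using kernel[of 1 t "t\<^sup>2"] val by metis
      then show False by simp
    qed
    with eq show ?thesis by blast
  qed
  \<comment> \<open>Nodes are simple: equal logarithmic derivatives \<open>\<nu>\<close> would contradict independence.\<close>
  have "rsquarefree h"
    unfolding rsquarefree_roots
  proof (intro allI notI, elim conjE)
    fix t assume t: "poly h t = 0" "poly (pderiv h) t = 0"
    obtain \<mu> where \<mu>: "\<mu> \<noteq> 0" "\<And>i. i < 4 \<Longrightarrow> l i * poly (p i) t ^ 4 = \<mu>"
      using node[OF t(1)] by blast
    define \<kappa> where "\<kappa> = l 3 * poly (p 3) t ^ 3 * poly (pderiv (p 3)) t"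
    have eq: "l i * poly (p i) t ^ 3 * poly (pderiv (p i)) t = \<kappa>" if "i < 4" for i
    proof (cases "i = 3")
      case False
      with that h'[of i] obtain g where "smult D (w i) = h * g" by auto
      then have "poly (pderiv (smult D (w i))) t = poly (pderiv (h * g)) t" by simp
      also have "\<dots> = 0" using t by (simp add: pderiv_mult)
      finally have "4 * (D * (l i * poly (p i) t ^ 3 * poly (pderiv (p i)) t - \<kappa>)) = 0"
        by (simp add: w_def \<kappa>_def pderiv_smult pderiv_diff pderiv_power algebra_simps)
      then show ?thesis using det by (simp add: D_def)
    qed (simp add: \<kappa>_def)
    have "\<mu> * poly (pderiv (p i)) t = \<kappa> * poly (p i) t" if "i < 4" for i
      unfolding \<mu>(2)[OF that, symmetric] eq[OF that, symmetric] by (simp add: eval_nat_numeral)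
    then have \<nu>: "poly (pderiv (p i)) t = \<kappa> / \<mu> * poly (p i) t" if "i < 4" for i
      using that \<mu>(1) by (simp add: field_simps)
    define \<nu> where "\<nu> = \<kappa> / \<mu>"
    have "coeff (p i) 0 * (- \<nu>) + coeff (p i) 1 * (1 - \<nu> * t)
        + coeff (p i) 2 * (2 * t - \<nu> * t\<^sup>2) = 0" if "i < 4" for i
      using \<nu>[OF that, folded \<nu>_def] unfolding val[OF that] by (simp add: algebra_simps)
    from kernel[OF this] have "- \<nu> = 0" "1 - \<nu> * t = 0" by blast+
    then show False by simp
  qed
  \<comment> \<open>If the degree is smaller, the coefficients of the \<open>w i\<close> in degrees \<open>8\<close> and \<open>7\<close> vanish,
    which is the previous argument at infinity.\<close>
  moreover have "degree h \<ge> 5"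
  proof (rule ccontr)
    assume small: "\<not> degree h \<ge> 5"
    have top: "coeff (w i) n = 0" if i: "i < 3" and n: "n > 6" for i n
    proof -
      obtain g where g: "smult D (w i) = h * g" "degree g \<le> 2" using h'[OF i] by blast
      have "degree (smult D (w i)) \<le> 6"
        unfolding g(1) using degree_mult_le[of h g] g(2) small by linarith
      then show ?thesis using n det by (simp add: D_def coeff_eq_0)
    qed
    have co: "coeff (p i ^ 4) 8 = coeff (p i) 2 ^ 4" "coeff (p i ^ 4) 7 = 4 * (coeff (p i) 2 ^ 3 * coeff (p i) 1)"
      if i: "i < 4" for i
    proof -
      obtain a b c where "p i = [:a, b, c:]" using degree_le_2_eq[OF deg[OF i]] by blast
      then show "coeff (p i ^ 4) 8 = coeff (p i) 2 ^ 4"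
        "coeff (p i ^ 4) 7 = 4 * (coeff (p i) 2 ^ 3 * coeff (p i) 1)"
        by (simp_all add: top_coeffs numeral_2_eq_2)
    qed
    define \<mu> where "\<mu> = l 3 * coeff (p 3) 2 ^ 4"
    define \<kappa> where "\<kappa> = l 3 * coeff (p 3) 2 ^ 3 * coeff (p 3) 1"
    have eq8: "l i * coeff (p i) 2 ^ 4 = \<mu>" if "i < 4" for i
    proof (cases "i = 3")
      case False
      with that have "coeff (w i) 8 = 0" by (intro top) auto
      then show ?thesis
        unfolding w_def coeff_diff coeff_smult \<mu>_def by (simp add: co that)
    qed (simp add: \<mu>_def)
    have eq7: "l i * coeff (p i) 2 ^ 3 * coeff (p i) 1 = \<kappa>" if "i < 4" for i
    proof (cases "i = 3")
      case False
      with that have "coeff (w i) 7 = 0" by (intro top) auto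
      then show ?thesis
        unfolding w_def coeff_diff coeff_smult \<kappa>_def by (simp add: co that mult.assoc)
    qed (simp add: \<kappa>_def)
    have "\<mu> \<noteq> 0"
    proof
      assume "\<mu> = 0"
      have "coeff (p i) 0 * 0 + coeff (p i) 1 * 0 + coeff (p i) 2 * 1 = 0" if "i < 4" for i
        using eq8[OF that] l[OF that] \<open>\<mu> = 0\<close> by simp
      from kernel[OF this] show False by simp
    qed
    define \<nu> where "\<nu> = \<kappa> / \<mu>"
    have "coeff (p i) 0 * 0 + coeff (p i) 1 * 1 + coeff (p i) 2 * (- \<nu>) = 0" if "i < 4" for i
    proof -
      have "\<mu> * coeff (p i) 1 = \<kappa> * coeff (p i) 2"
        unfolding eq8[OF that, symmetric] eq7[OF that, symmetric]
        by (simp add: power4_eq_xxxx power3_eq_cube)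
      then show ?thesis using \<open>\<mu> \<noteq> 0\<close> by (simp add: \<nu>_def field_simps)
    qed
    from kernel[OF this] show False by simp
  qed
  ultimately show thesis
  proof (intro that)
    assume *: "rsquarefree h" "degree h \<ge> 5"
    then have "h \<noteq> 0" by auto
    have "degree h = degree (smult (lead_coeff h) (\<Prod>z | poly h z = 0. [:- z, 1:]))"
      by (simp only: complex_poly_decompose_rsquarefree[OF *(1)])
    also have "\<dots> = card {t. poly h t = 0}"
      using \<open>h \<noteq> 0\<close> by (simp add: degree_prod_sum_eq)
    finally show "card {t. poly h t = 0} \<ge> 5" using *(2) by simp
  qed (use node in auto)
qed

section \<open>Equality of the coefficients\<close>

lemma sum_four_distinct:
  assumes "distinct [i, j, k, m]" "set [i, j, k, m] \<subseteq> {..<4::nat}"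
  shows "sum f {..<4} = f i + f j + f k + f m" "{..<4} = {i, j, k, m}"
proof -
  have "card (set [i, j, k, m]) = card {..<4::nat}"
    using assms(1) by (simp only: distinct_card) simp
  then show e: "{..<4} = {i, j, k, m}"
    using card_subset_eq[OF _ assms(2)] by auto
  show "sum f {..<4} = f i + f j + f k + f m"
    unfolding e using assms(1) by (simp add: add.assoc)
qed

lemma fourth_root_of_unity_cases:
  assumes "(z::complex) ^ 4 = 1"
  shows "z = 1 \<or> z = -1 \<or> z = \<i> \<or> z = -\<i>"
proof -
  have "(z - 1) * (z + 1) * ((z - \<i>) * (z + \<i>)) = z ^ 4 - 1"
    by (simp add: eval_nat_numeral algebra_simps)
  then have "(z - 1) * (z + 1) * ((z - \<i>) * (z + \<i>)) = 0"
    using assms by simp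
  then show ?thesis
    unfolding mult_eq_0_iff by (simp add: eq_neg_iff_add_eq_0)
qed

lemma one_minus_fourth_root_of_unity:
  assumes "(z::complex) ^ 4 = 1" "z \<noteq> 1"
  shows "(1 - z) ^ 4 = 16 \<or> (1 - z) ^ 4 = -4"
proof -
  have "(1 - \<i>) ^ 4 = -4" "(1 + \<i>) ^ 4 = -4"
    by (simp_all add: eval_nat_numeral algebra_simps)
  then show ?thesis
    using fourth_root_of_unity_cases[OF assms(1)] assms(2) by auto
qed

text \<open>
  Four values are possible for \<open>p\<^sub>i / p\<^sub>j\<close> at a node, so two nodes \<open>t \<noteq> s\<close> share one.  Let \<open>u\<close> be the vector
  of values at \<open>t\<close>, and \<open>v\<close> the one at \<open>s\<close> scaled by \<open>\<sigma>\<close> so that it agrees with \<open>u\<close> in the coordinates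
  \<open>i\<close> and \<open>j\<close>.  The coordinates sum to zero and the fourth powers agree, so \<open>v\<^sub>k = \<epsilon>\<^sub>k u\<^sub>k\<close>, \<open>v\<^sub>m = \<epsilon>\<^sub>m u\<^sub>m\<close> with fourth
  roots of unity, and \<open>(1 - \<epsilon>\<^sub>k) u\<^sub>k + (1 - \<epsilon>\<^sub>m) u\<^sub>m = 0\<close>.  Neither root is \<open>1\<close>, since \<open>u \<noteq> v\<close>.  As \<open>(1 - \<epsilon>)\<^sup>4\<close> is then
  \<open>16\<close> or \<open>-4\<close>, the fourth power of the equation yields the ratio.
\<close>

lemma coefficient_ratio:
  fixes p :: "nat \<Rightarrow> complex poly" and l :: "nat \<Rightarrow> complex"
  assumes deg: "\<And>i. i < 4 \<Longrightarrow> degree (p i) \<le> 2"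
    and det: "det3 (p 0) (p 1) (p 2) \<noteq> 0"
    and l: "\<And>i. i < 4 \<Longrightarrow> l i \<noteq> 0"
    and lin: "(\<Sum>i<4. p i) = 0"
    and T: "card T \<ge> 5"
    and node: "\<And>t. t \<in> T \<Longrightarrow> \<exists>\<mu>. \<mu> \<noteq> 0 \<and> (\<forall>i<4. l i * poly (p i) t ^ 4 = \<mu>)"
    and dist: "distinct [i, j, k, m]" "set [i, j, k, m] \<subseteq> {..<4}"
  shows "l k = l m \<or> l k = -4 * l m \<or> l m = -4 * l k"
proof -
  have lt: "i < 4" "j < 4" "k < 4" "m < 4" using dist(2) by auto
  define R where "R t = poly (p i) t / poly (p j) t" for t
  have nz: "poly (p n) t \<noteq> 0" if "t \<in> T" "n < 4" for t n
    using node[OF that(1)] that(2) by force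
  have "R ` T \<subseteq> {z. z ^ 4 = l j / l i}"
  proof clarify
    fix t assume t: "t \<in> T"
    from node[OF t] lt have "l i * poly (p i) t ^ 4 = l j * poly (p j) t ^ 4" by metis
    then show "R t ^ 4 = l j / l i"
      using nz[OF t lt(2)] l[OF lt(1)] by (simp add: R_def power_divide field_simps)
  qed
  moreover have "card {z::complex. z ^ 4 = l j / l i} = 4"
    using l lt by (intro card_nth_roots) auto
  ultimately have "card (R ` T) \<le> 4"
    by (metis card_mono card.infinite zero_neq_numeral)
  then have "\<not> inj_on R T" using T card_image[of R T] by fastforce
  then obtain t s where ts: "t \<in> T" "s \<in> T" "t \<noteq> s" "R t = R s"
    unfolding inj_on_def by blast
  define \<sigma> where "\<sigma> = poly (p j) t / poly (p j) s"
  define u where "u n = poly (p n) t" for n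
  define v where "v n = \<sigma> * poly (p n) s" for n
  have "\<sigma> \<noteq> 0" using nz ts lt by (simp add: \<sigma>_def)
  have uj: "v j = u j" using nz ts lt by (simp add: u_def v_def \<sigma>_def)
  have ui: "v i = u i"
    using ts(4) nz[OF ts(1) lt(2)] nz[OF ts(2) lt(2)]
    by (simp add: u_def v_def \<sigma>_def R_def field_simps)
  have unz: "u n \<noteq> 0" if "n < 4" for n using nz[OF ts(1) that] by (simp add: u_def)
  have su: "u i + u j + u k + u m = 0"
  proof -
    have "poly (\<Sum>n<4. p n) t = u i + u j + u k + u m"
      unfolding sum_four_distinct(1)[OF dist] by (simp add: u_def)
    then show ?thesis by (simp add: lin)
  qed
  have sv: "v i + v j + v k + v m = 0"
  proof -
    have "\<sigma> * poly (\<Sum>n<4. p n) s = v i + v j + v k + v m"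
      unfolding sum_four_distinct(1)[OF dist] by (simp add: v_def algebra_simps)
    then show ?thesis by (simp add: lin)
  qed
  obtain \<mu> where \<mu>: "\<mu> \<noteq> 0" "\<And>n. n < 4 \<Longrightarrow> l n * u n ^ 4 = \<mu>"
    using node[OF ts(1)] unfolding u_def by blast
  have \<mu>': "l n * v n ^ 4 = \<mu>" if "n < 4" for n
  proof -
    obtain \<nu> where \<nu>: "\<And>n. n < 4 \<Longrightarrow> l n * poly (p n) s ^ 4 = \<nu>"
      using node[OF ts(2)] by blast
    have "l n * v n ^ 4 = \<sigma> ^ 4 * \<nu>" if "n < 4" for n
      using \<nu>[OF that, symmetric] by (simp add: v_def power_mult_distrib algebra_simps)
    then show ?thesis using \<mu>(2)[OF lt(1)] ui lt that by metis
  qed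
  define \<epsilon> where "\<epsilon> n = v n / u n" for n
  have \<epsilon>4: "\<epsilon> n ^ 4 = 1" if "n < 4" for n
    using \<mu>(2)[OF that] \<mu>'[OF that] \<mu>(1) l[OF that] unz[OF that]
    by (simp add: \<epsilon>_def power_divide) (metis mult_left_cancel)
  have v: "v n = \<epsilon> n * u n" if "n < 4" for n
    using unz[OF that] by (simp add: \<epsilon>_def)
  have key: "(1 - \<epsilon> k) * u k = - ((1 - \<epsilon> m) * u m)"
    using su sv ui uj v[OF lt(3)] v[OF lt(4)] by algebra
  have ne: "\<epsilon> k \<noteq> 1" "\<epsilon> m \<noteq> 1"
  proof -
    \<comment> \<open>Otherwise \<open>u = v\<close>, and evaluation at \<open>t\<close> would be \<open>\<sigma>\<close> times evaluation at \<open>s\<close> on all quadratics,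
      so that \<open>\<sigma> = 1\<close> and \<open>t = s\<close>.\<close>
    have "\<not> (\<epsilon> k = 1 \<and> \<epsilon> m = 1)"
    proof
      assume "\<epsilon> k = 1 \<and> \<epsilon> m = 1"
      then have "v n = u n" if "n < 4" for n
        using that sum_four_distinct(2)[OF dist] ui uj v[OF lt(3)] v[OF lt(4)]
        by (metis insertE lessThan_iff mult_1 singletonD)
      then have eq: "poly (p n) t = \<sigma> * poly (p n) s" if "n < 4" for n
        using that by (simp add: u_def v_def)
      have "coeff (p n) 0 * (1 - \<sigma>) + coeff (p n) 1 * (t - \<sigma> * s) + coeff (p n) 2 * (t\<^sup>2 - \<sigma> * s\<^sup>2) = 0" if n: "n < 4" for n
      proof -
        obtain a b c where "p n = [:a, b, c:]" using degree_le_2_eq[OF deg[OF n]] by blast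
        then show ?thesis using eq[OF n] by (simp add: numeral_2_eq_2 algebra_simps)
      qed
      from this[of 0] this[of 1] this[of 2]
      have "coeff f 0 * (1 - \<sigma>) + coeff f 1 * (t - \<sigma> * s) + coeff f 2 * (t\<^sup>2 - \<sigma> * s\<^sup>2) = 0"
        if "f \<in> {p 0, p 1, p 2}" for f using that by auto
      from det3_kernel(1,2)[OF det this] ts(3) show False by simp
    qed
    moreover have "\<epsilon> k = 1 \<longleftrightarrow> \<epsilon> m = 1"
      using key unz lt by auto
    ultimately show "\<epsilon> k \<noteq> 1" "\<epsilon> m \<noteq> 1" by auto
  qed
  have "(1 - \<epsilon> k) ^ 4 * u k ^ 4 = (1 - \<epsilon> m) ^ 4 * u m ^ 4"
    using key by (metis power_minus_even even_numeral power_mult_distrib)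
  then have "(1 - \<epsilon> k) ^ 4 * (l k * u k ^ 4) * l m = (1 - \<epsilon> m) ^ 4 * (l m * u m ^ 4) * l k"
    by (simp add: mult_ac)
  then have "(1 - \<epsilon> k) ^ 4 * l m = (1 - \<epsilon> m) ^ 4 * l k"
    using \<mu>(1) by (simp add: \<mu>(2) lt mult_ac)
  moreover have "b = a \<or> b = -4 * a \<or> a = -4 * b"
    if "x * a = y * b" "x = 16 \<or> x = -4" "y = 16 \<or> y = -4" for x y a b :: complex
    using that by (elim disjE; simp add: complex_eq_iff)
  ultimately show ?thesis
    using one_minus_fourth_root_of_unity[OF \<epsilon>4[OF lt(3)] ne(1)]
      one_minus_fourth_root_of_unity[OF \<epsilon>4[OF lt(4)] ne(2)] by blast
qed

text \<open>
  A parity argument: a sum of three units of the Gaussian integers has odd norm, whereas a number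
  whose fourth power is \<open>-4\<close> or \<open>-1/4\<close> has norm \<open>2\<close> or \<open>1/2\<close>.
\<close>

lemma units_sum_fourth_power:
  assumes "(a::complex) ^ 4 = 1" "(b::complex) ^ 4 = 1" "(c::complex) ^ 4 = 1"
  shows "(a + b + c) ^ 4 \<noteq> -4" "4 * (a + b + c) ^ 4 \<noteq> -1"
proof -
  define n where "n = (cmod (a + b + c))\<^sup>2"
  have "n = (Re a + Re b + Re c)\<^sup>2 + (Im a + Im b + Im c)\<^sup>2"
    by (simp add: n_def cmod_power2)
  then have n: "n \<in> {1, 5, 9}"
    using fourth_root_of_unity_cases[OF assms(1)] fourth_root_of_unity_cases[OF assms(2)]
      fourth_root_of_unity_cases[OF assms(3)]
    by (elim disjE; simp)
  have n2: "cmod ((a + b + c) ^ 4) = n\<^sup>2"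
    by (simp add: n_def norm_power flip: power_mult)
  show "(a + b + c) ^ 4 \<noteq> -4"
  proof
    assume "(a + b + c) ^ 4 = -4"
    with n2 have "n\<^sup>2 = 4" by simp
    with n show False by auto
  qed
  show "4 * (a + b + c) ^ 4 \<noteq> -1"
  proof
    assume "4 * (a + b + c) ^ 4 = -1"
    then have "cmod (4 * (a + b + c) ^ 4) = 1" by simp
    then have "4 * n\<^sup>2 = 1" by (simp only: norm_mult n2) simp
    with n show False by auto
  qed
qed

text \<open>
  A pattern of three equal coefficients \<open>\<rho>\<close> and a different \<open>\<sigma>\<close> admits no node at all: divided by \<open>a\<close>, the
  coordinates \<open>a, b, c\<close> are units, and their sum has a forbidden fourth power.
\<close>

lemma node_three_one:
  fixes a b c d :: complex
  assumes sum: "a + b + c + d = 0"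
    and node: "\<mu> \<noteq> 0" "\<rho> * a ^ 4 = \<mu>" "\<rho> * b ^ 4 = \<mu>" "\<rho> * c ^ 4 = \<mu>" "\<sigma> * d ^ 4 = \<mu>"
  shows "\<sigma> \<noteq> -4 * \<rho>" "\<rho> \<noteq> -4 * \<sigma>"
proof -
  have nz: "a \<noteq> 0" "\<rho> \<noteq> 0" "\<sigma> \<noteq> 0" using node by auto
  define y z where "y = b / a" and "z = c / a"
  have yz: "b = y * a" "c = z * a" using nz by (simp_all add: y_def z_def)
  have "\<mu> * y ^ 4 = \<mu>" "\<mu> * z ^ 4 = \<mu>"
    using node(3,4) unfolding yz power_mult_distrib by (simp_all add: node(2)[symmetric] mult_ac)
  then have yz4: "y ^ 4 = 1" "z ^ 4 = 1" using node(1) by simp_all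
  define S where "S = (1 + y + z) ^ 4"
  have "d = - ((1 + y + z) * a)"
    using sum unfolding yz by (simp add: algebra_simps eq_neg_iff_add_eq_0)
  then have "d ^ 4 = S * a ^ 4"
    by (simp add: S_def power_mult_distrib)
  then have "\<rho> * a ^ 4 = \<sigma> * S * a ^ 4"
    using node(2,5) by (simp add: mult.assoc)
  then have \<rho>: "\<rho> = \<sigma> * S" using nz by simp
  have S: "S \<noteq> -4" "4 * S \<noteq> -1"
    using units_sum_fourth_power[of 1 y z] yz4 by (simp_all add: S_def)
  show "\<rho> \<noteq> -4 * \<sigma>"
  proof
    assume "\<rho> = -4 * \<sigma>"
    then have "\<sigma> * (S + 4) = 0" unfolding \<rho> by (simp add: algebra_simps)
    with nz S(1) show False by (simp add: eq_neg_iff_add_eq_0)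
  qed
  show "\<sigma> \<noteq> -4 * \<rho>"
  proof
    assume "\<sigma> = -4 * \<rho>"
    then have "\<sigma> + 4 * \<rho> = 0" by simp
    then have "\<sigma> * (4 * S + 1) = 0" by (simp add: \<rho> algebra_simps)
    with nz S(2) show False by (simp add: eq_neg_iff_add_eq_0)
  qed
qed

text \<open>
  A pattern of two equal pairs of coefficients does admit nodes, but with \<open>y = -b/a\<close> and \<open>z = -d/c\<close> they
  satisfy \<open>-4 (1 - y)\<^sup>4 = (1 - z)\<^sup>4\<close>.  As \<open>(1 - z)\<^sup>4 = -4\<close> would need \<open>(1 - y)\<^sup>4 = 1\<close>, only \<open>z = \<plusminus>1\<close> remains.
\<close>

lemma node_two_two:
  fixes a b c d :: complex
  assumes sum: "a + b + c + d = 0"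
    and node: "\<mu> \<noteq> 0" "\<rho> * a ^ 4 = \<mu>" "\<rho> * b ^ 4 = \<mu>" "\<sigma> * c ^ 4 = \<mu>" "\<sigma> * d ^ 4 = \<mu>"
    and ratio: "\<sigma> = -4 * \<rho>"
  shows "c\<^sup>2 = d\<^sup>2"
proof -
  have nz: "a \<noteq> 0" "c \<noteq> 0" "\<rho> \<noteq> 0" using node by auto
  define y z where "y = - b / a" and "z = - d / c"
  have yz: "b = - (y * a)" "d = - (z * c)" using nz by (simp_all add: y_def z_def)
  have "\<mu> * y ^ 4 = \<rho> * b ^ 4"
    unfolding yz node(2)[symmetric] by (simp add: power_mult_distrib)
  moreover have "\<mu> * z ^ 4 = \<sigma> * d ^ 4"
    unfolding yz node(4)[symmetric] by (simp add: power_mult_distrib)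
  ultimately have "\<mu> * y ^ 4 = \<mu>" "\<mu> * z ^ 4 = \<mu>"
    by (simp_all only: node)
  then have yz4: "y ^ 4 = 1" "z ^ 4 = 1" using node(1) by simp_all
  have "(1 - y) * a = - ((1 - z) * c)"
    using sum unfolding yz by (simp add: algebra_simps eq_neg_iff_add_eq_0)
  then have "((1 - y) * a) ^ 4 = ((1 - z) * c) ^ 4"
    by simp
  then have *: "(1 - y) ^ 4 * a ^ 4 = (1 - z) ^ 4 * c ^ 4"
    by (simp only: power_mult_distrib)
  have "\<mu> * (-4 * (1 - y) ^ 4) = \<sigma> * ((1 - y) ^ 4 * a ^ 4)"
    unfolding node(2)[symmetric] ratio by simp
  also have "\<dots> = \<mu> * (1 - z) ^ 4"
    unfolding * node(4)[symmetric] by simp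
  finally have "\<mu> * (-4 * (1 - y) ^ 4) = \<mu> * (1 - z) ^ 4" .
  then have eq: "-4 * (1 - y) ^ 4 = (1 - z) ^ 4"
    using node(1) mult_left_cancel by blast
  have "z = 1 \<or> z = -1"
  proof (rule ccontr)
    assume "\<not> ?thesis"
    then have "z = \<i> \<or> z = - \<i>"
      using fourth_root_of_unity_cases[OF yz4(2)] by blast
    then have "(1 - z) ^ 4 = -4"
      by (auto simp: power4_eq_xxxx algebra_simps)
    with eq have "(1 - y) ^ 4 = 1" by simp
    with one_minus_fourth_root_of_unity[OF yz4(1)] show False by (cases "y = 1") auto
  qed
  then show ?thesis unfolding yz by auto
qed

text \<open>
  If the coefficients are not all equal, the possible ratios leave two values, one \<open>-4\<close> times the
  other.  The split \<open>3 + 1\<close> is impossible at any node.  In the split \<open>2 + 2\<close> the polynomial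
  \<open>p\<^sub>n\<^sup>2 - p\<^sub>a\<^sup>2\<close>, for the pair with the larger coefficient, has degree at most \<open>4\<close> and vanishes at the
  five nodes; so it is zero, and \<open>p\<^sub>n = \<plusminus>p\<^sub>a\<close>.
\<close>

lemma coefficients_equal:
  fixes p :: "nat \<Rightarrow> complex poly" and l :: "nat \<Rightarrow> complex"
  assumes deg: "\<And>i. i < 4 \<Longrightarrow> degree (p i) \<le> 2"
    and wr: "\<And>i j. i < 4 \<Longrightarrow> j < 4 \<Longrightarrow> i \<noteq> j \<Longrightarrow> wronskian (p i) (p j) \<noteq> 0"
    and det: "det3 (p 0) (p 1) (p 2) \<noteq> 0"
    and l: "\<And>i. i < 4 \<Longrightarrow> l i \<noteq> 0"
    and lin: "(\<Sum>i<4. p i) = 0"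
    and quint: "(\<Sum>i<4. smult (l i) (p i ^ 5)) = 0"
    and km: "k < 4" "m < 4"
  shows "l k = l m"
proof (rule ccontr)
  assume neq: "l k \<noteq> l m"
  obtain T where T: "card T \<ge> 5"
    and node: "\<And>t. t \<in> T \<Longrightarrow> \<exists>\<mu>. \<mu> \<noteq> 0 \<and> (\<forall>i<4. l i * poly (p i) t ^ 4 = \<mu>)"
    using five_nodes[OF deg det l lin quint] by blast
  have others: "\<exists>i j. distinct [i, j, k, m] \<and> set [i, j, k, m] \<subseteq> {..<4}" if "k < 4" "m < 4" "k \<noteq> m" for k m :: nat
  proof -
    have "card ({..<4} - {k, m}) = 2"
      using that by (subst card_Diff_subset) auto
    then obtain i j where "{..<4} - {k, m} = {i, j}" "i \<noteq> j" unfolding card_2_iff by blast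
    then have "i \<in> {..<4} - {k, m}" "j \<in> {..<4} - {k, m}" by blast+
    then show ?thesis using \<open>i \<noteq> j\<close> that by (intro exI[of _ i] exI[of _ j]) auto
  qed
  have ratio: "l k = l m \<or> l k = -4 * l m \<or> l m = -4 * l k" if "k < 4" "m < 4" for k m
  proof (cases "k = m")
    case False
    with others[OF that] obtain i j where "distinct [i, j, k, m]" "set [i, j, k, m] \<subseteq> {..<4}" by blast
    from coefficient_ratio[OF deg det l lin T node this] show ?thesis .
  qed simp
  obtain a b where ab: "a < 4" "b < 4" "l a = -4 * l b"
    using ratio[OF km] neq km by blast
  have lb: "l b \<noteq> 0" using l ab(2) .
  have "a \<noteq> b"
  proof
    assume "a = b"
    have "5 * l b = l b - (-4 * l b)" by simp
    also have "\<dots> = 0"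
      unfolding ab(3)[unfolded \<open>a = b\<close>, symmetric] by simp
    finally show False using lb by simp
  qed
  then obtain i j where ij: "distinct [i, j, a, b]" "set [i, j, a, b] \<subseteq> {..<4}"
    using others ab by blast
  have two: "l n = l a \<or> l n = l b" if "n < 4" for n
  proof -
    \<comment> \<open>With \<open>y = l b\<close> and \<open>l a = -4 y\<close>, the remaining option \<open>y = -4 x\<close> makes \<open>x / l a = 1/16\<close>, not an allowed ratio.\<close>
    have "x = -4 * y \<or> x = y"
      if "y \<noteq> 0" "x = y \<or> x = -4 * y \<or> y = -4 * x" "x = -4 * y \<or> x = -4 * (-4 * y) \<or> -4 * y = -4 * x"
      for x y :: complex
    proof (rule ccontr)
      assume neq: "\<not> ?thesis"
      with that(2,3) have *: "y = -4 * x" "x = -4 * (-4 * y) \<or> -4 * y = -4 * x" by blast+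
      from *(2) have "65 * y = 0"
      proof
        assume "x = -4 * (-4 * y)"
        then show ?thesis using *(1) by algebra
      next
        assume "-4 * y = -4 * x"
        then have "x = y" by simp
        with neq show ?thesis by blast
      qed
      with that(1) show False by simp
    qed
    from this[OF lb ratio[OF that ab(2)] ratio[OF that ab(1), unfolded ab(3)]] show ?thesis
      unfolding ab(3) .
  qed
  have sum0: "poly (p i) t + poly (p j) t + poly (p a) t + poly (p b) t = 0" for t
  proof -
    have "poly (\<Sum>n<4. p n) t = poly (p i) t + poly (p j) t + poly (p a) t + poly (p b) t"
      unfolding sum_four_distinct(1)[OF ij] by simp
    then show ?thesis by (simp add: lin)
  qed
  have ijlt: "i < 4" "j < 4" using ij by auto
  have "T \<noteq> {}" using T by auto
  then obtain t where t: "t \<in> T" by blast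
  then obtain \<mu> where \<mu>: "\<mu> \<noteq> 0" "\<And>n. n < 4 \<Longrightarrow> l n * poly (p n) t ^ 4 = \<mu>"
    using node by blast
  have not_two_two: False if mn: "m < 4" "n < 4" "l m = l b" "l n = l a" "n \<noteq> a"
    and sum: "\<And>t. poly (p m) t + poly (p b) t + poly (p n) t + poly (p a) t = 0" for m n
  proof -
    define d where "d = (p n)\<^sup>2 - (p a)\<^sup>2"
    have "T \<subseteq> {t. poly d t = 0}"
    proof
      fix t assume "t \<in> T"
      then obtain \<nu> where \<nu>: "\<nu> \<noteq> 0" "\<And>n. n < 4 \<Longrightarrow> l n * poly (p n) t ^ 4 = \<nu>"
        using node by blast
      have "(poly (p n) t)\<^sup>2 = (poly (p a) t)\<^sup>2"
        by (rule node_two_two[OF sum \<nu>(1) \<nu>(2)[OF mn(1), unfolded mn(3)] \<nu>(2)[OF ab(2)]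
              \<nu>(2)[OF mn(2), unfolded mn(4)] \<nu>(2)[OF ab(1)] ab(3)])
      then show "t \<in> {t. poly d t = 0}" by (simp add: d_def)
    qed
    moreover have "degree d \<le> 4"
      unfolding d_def using deg[OF mn(2)] deg[OF ab(1)]
      by (intro degree_diff_le order.trans[OF degree_power_le]) auto
    ultimately have "card T \<le> 4" if "d \<noteq> 0"
      using card_mono[OF poly_roots_finite[OF that], of T] card_poly_roots_bound[OF that] by linarith
    then have "d = 0" using T by linarith
    then have "p n = p a \<or> p n = - p a"
      by (simp add: d_def power2_eq_iff)
    then have "wronskian (p n) (p a) = 0"
      by (auto simp: wronskian_def pderiv_minus)
    with wr mn(2,5) ab(1) show False by blast
  qed
  consider "l i = l b" "l j = l b" | "l i = l a" "l j = l a" | "l i = l b" "l j = l a" | "l i = l a" "l j = l b"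
    using two[OF ijlt(1)] two[OF ijlt(2)] by blast
  then show False
  proof cases
    case 1
    have "poly (p i) t + poly (p j) t + poly (p b) t + poly (p a) t = 0"
      using sum0[of t] by (simp only: add_ac)
    from node_three_one(1)[OF this \<mu>(1) \<mu>(2)[OF ijlt(1), unfolded 1] \<mu>(2)[OF ijlt(2), unfolded 1]
        \<mu>(2)[OF ab(2)] \<mu>(2)[OF ab(1)]] ab(3)
    show False by blast
  next
    case 2
    from node_three_one(2)[OF sum0[of t] \<mu>(1) \<mu>(2)[OF ijlt(1), unfolded 2] \<mu>(2)[OF ijlt(2), unfolded 2]
        \<mu>(2)[OF ab(1)] \<mu>(2)[OF ab(2)]] ab(3)
    show False by blast
  next
    case 3
    have "poly (p i) t + poly (p b) t + poly (p j) t + poly (p a) t = 0" for t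
      using sum0[of t] by (simp only: add_ac)
    from not_two_two[OF ijlt 3 _ this] ij(1) show False by simp
  next
    case 4
    have "poly (p j) t + poly (p b) t + poly (p i) t + poly (p a) t = 0" for t
      using sum0[of t] by (simp only: add_ac)
    from not_two_two[OF ijlt(2,1) 4(2,1) _ this] ij(1) show False by simp
  qed
qed

text \<open>
  With \<open>w = -(x + y + z)\<close> the left-hand side is the fifth power sum of four numbers with sum zero,
  and the last factor on the right is half the sum of their squares.
\<close>

lemma quintic_power_sum_factorisation:
  fixes x y z :: "'a::idom"
  shows "x ^ 5 + y ^ 5 + z ^ 5 - (x + y + z) ^ 5
    = - 5 * ((x + y) * (y + z) * (z + x) * (x\<^sup>2 + y\<^sup>2 + z\<^sup>2 + x * y + y * z + z * x))"
  by algebra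

section \<open>Three forms in a pencil\<close>

text \<open>
  The value at \<open>(x, y)\<close> of the binary form of degree \<open>2\<close> whose dehomogenisation at \<open>x = 1\<close> is \<open>p\<close>.
\<close>

definition quad :: "complex poly \<Rightarrow> complex \<Rightarrow> complex \<Rightarrow> complex" where
  "quad p x y = coeff p 0 * x\<^sup>2 + coeff p 1 * x * y + coeff p 2 * y\<^sup>2"

lemma quad_add: "quad (p + q) x y = quad p x y + quad q x y"
  by (simp add: quad_def algebra_simps)

lemma quad_smult: "quad (smult c p) x y = c * quad p x y"
  by (simp add: quad_def algebra_simps)

lemma poly_eq_quad: "degree p \<le> 2 \<Longrightarrow> poly p t = quad p 1 t"
  by (subst degree_le_2_eq) (simp_all add: quad_def power2_eq_square algebra_simps)

lemma binary_quadratic_splits: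
  obtains v1 v2 w1 w2 :: complex
  where "v1 * w1 = A" "v1 * w2 + v2 * w1 = B" "v2 * w2 = C"
proof (cases "A = 0")
  case True
  then show ?thesis by (intro that[of 0 B C 1]) auto
next
  case False
  define d where "d = csqrt (B\<^sup>2 - 4 * A * C)"
  have d: "d\<^sup>2 = B\<^sup>2 - 4 * A * C" by (simp add: d_def)
  show ?thesis
  proof (rule that[of A 1 "(B + d) / (2 * A)" "(B - d) / 2"])
    show "(B - d) / 2 * ((B + d) / (2 * A)) = C"
      using False d by (simp add: field_simps power2_eq_square)
  qed (use False in \<open>auto simp: field_simps\<close>)
qed

text \<open>
  With \<open>S = e + k t\<^sup>2\<close> and \<open>D = g t\<close>, the difference \<open>(S + D)\<^sup>5 - (S - D)\<^sup>5\<close> is \<open>2 D (5 S\<^sup>4 + 10 S\<^sup>2 D\<^sup>2 + D\<^sup>4)\<close>.  If \<open>g \<noteq> 0\<close>, the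
  second factor vanishes identically.  At \<open>t = 0\<close> this gives \<open>e = 0\<close>; after division by \<open>t\<^sup>4\<close> it
  gives \<open>g = 0\<close>.
\<close>

lemma even_quintic_power:
  assumes "\<And>t. (e + g * t + k * t\<^sup>2) ^ 5 = (e - g * t + k * t\<^sup>2) ^ (5::nat)"
  shows "(g::complex) = 0"
proof (rule ccontr)
  assume g: "g \<noteq> 0"
  define S where "S = [:e, 0, k:]"
  define D where "D = [:0, g:]"
  have "poly ((S + D) ^ 5) t = poly ((S - D) ^ 5) t" for t
    using assms[of t] by (simp add: S_def D_def power2_eq_square algebra_simps)
  then have "(S + D) ^ 5 = (S - D) ^ 5"
    by (simp add: poly_eq_poly_eq_iff[symmetric] fun_eq_iff)
  then have "2 * D * (5 * S ^ 4 + 10 * S\<^sup>2 * D\<^sup>2 + D ^ 4) = 0"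
    by algebra
  moreover have "2 * D \<noteq> 0"
    using g by (simp add: D_def)
  ultimately have P: "5 * S ^ 4 + 10 * S\<^sup>2 * D\<^sup>2 + D ^ 4 = 0"
    using mult_eq_0_iff by blast
  then have "poly (5 * S ^ 4 + 10 * S\<^sup>2 * D\<^sup>2 + D ^ 4) 0 = 0" by simp
  then have "e = 0" by (simp add: S_def D_def)
  define X :: "complex poly" where "X = [:0, 1:]"
  have "S = X * [:0, k:]" "D = X * [:g:]"
    by (simp_all add: S_def D_def X_def \<open>e = 0\<close>)
  then have "X ^ 4 * (5 * [:0, k:] ^ 4 + 10 * [:0, k:]\<^sup>2 * [:g:]\<^sup>2 + [:g:] ^ 4) = 0"
    using P by algebra
  then have "5 * [:0, k:] ^ 4 + 10 * [:0, k:]\<^sup>2 * [:g:]\<^sup>2 + [:g:] ^ 4 = 0"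
    by (simp add: X_def)
  then have "poly (5 * [:0, k:] ^ 4 + 10 * [:0, k:]\<^sup>2 * [:g:]\<^sup>2 + [:g:] ^ 4) 0 = 0" by simp
  then show False using g by simp
qed

text \<open>
  The pencil spanned by \<open>p\<close> and \<open>q\<close> is the kernel of a linear functional on quadratic forms, and every
  such functional is \<open>f \<mapsto> 2 f(v, w)\<close>, the polarisation at a pair of vectors obtained by splitting a binary
  quadratic.  So the members of the pencil satisfy \<open>f (v + t w) = f (v - t w)\<close>; if \<open>v\<close> and \<open>w\<close> are
  independent, this is an involution of the projective line under which the pencil is invariant, and
  otherwise \<open>v\<close> is a base point of the pencil.  In both cases the relation makes \<open>s (v + t w)\<^sup>5\<close> even in \<open>t\<close>,
  while the odd part of \<open>s (v + t w)\<close> has the coefficient \<open>2 det3 p q s \<noteq> 0\<close>.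
\<close>

lemma outside_pencil_coefficient_zero:
  assumes det: "det3 p q s \<noteq> 0"
    and r: "r = smult a p + smult b q"
    and rel: "\<And>x y. c * quad s x y ^ 5 + c1 * quad p x y ^ 5 + c2 * quad q x y ^ 5 + c3 * quad r x y ^ 5 = 0"
  shows "c = 0"
proof (rule ccontr)
  assume c: "c \<noteq> 0"
  obtain v1 v2 w1 w2 where vw:
    "v1 * w1 = coeff p 1 * coeff q 2 - coeff p 2 * coeff q 1"
    "v1 * w2 + v2 * w1 = 2 * (coeff p 2 * coeff q 0 - coeff p 0 * coeff q 2)"
    "v2 * w2 = coeff p 0 * coeff q 1 - coeff p 1 * coeff q 0"
    by (rule binary_quadratic_splits)
  define polar where "polar f = 2 * coeff f 0 * (v1 * w1) + coeff f 1 * (v1 * w2 + v2 * w1) + 2 * coeff f 2 * (v2 * w2)" for f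
  have line: "quad f (v1 + t * w1) (v2 + t * w2) = quad f v1 v2 + polar f * t + quad f w1 w2 * t\<^sup>2" for f t
    by (simp add: quad_def polar_def power2_eq_square algebra_simps)
  have "polar p = 0" "polar q = 0" "polar s = 2 * det3 p q s"
    unfolding polar_def vw by (simp_all add: det3_def algebra_simps)
  moreover have "polar r = a * polar p + b * polar q"
    unfolding r by (simp add: polar_def algebra_simps)
  ultimately have sym: "quad f (v1 + t * w1) (v2 + t * w2) = quad f (v1 + (-t) * w1) (v2 + (-t) * w2)"
    if "f \<in> {p, q, r}" for f t
    using that unfolding line by auto
  have "c * quad s (v1 + t * w1) (v2 + t * w2) ^ 5 = c * quad s (v1 + (-t) * w1) (v2 + (-t) * w2) ^ 5" for t
    using rel[of "v1 + t * w1" "v2 + t * w2"] rel[of "v1 + (-t) * w1" "v2 + (-t) * w2"]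
      sym[of p t] sym[of q t] sym[of r t] by (simp add: add.assoc add_eq_0_iff2)
  then have "(quad s v1 v2 + polar s * t + quad s w1 w2 * t\<^sup>2) ^ 5
      = (quad s v1 v2 - polar s * t + quad s w1 w2 * t\<^sup>2) ^ 5" for t
    using c unfolding line by simp
  then have "polar s = 0" by (rule even_quintic_power)
  with \<open>polar s = 2 * det3 p q s\<close> det show False by simp
qed

lemma powers_in_pencil_independent:
  assumes "wronskian p q \<noteq> 0" "finite I" "card I \<le> Suc n"
    and span: "\<And>i. i \<in> I \<Longrightarrow> \<exists>a b. f i = smult a p + smult b q"
    and nz: "\<And>i. i \<in> I \<Longrightarrow> f i \<noteq> 0"
    and wr: "\<And>i j. i \<in> I \<Longrightarrow> j \<in> I \<Longrightarrow> i \<noteq> j \<Longrightarrow> wronskian (f i) (f j) \<noteq> 0"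
    and rel: "(\<Sum>i\<in>I. smult (c i) (f i ^ n)) = 0"
    and "i \<in> I"
  shows "c i = 0"
proof -
  obtain \<alpha> \<beta> where f: "\<And>i. i \<in> I \<Longrightarrow> f i = smult (\<alpha> i) p + smult (\<beta> i) q"
    using span by metis
  show ?thesis
  proof (rule powers_of_combinations_independent[OF assms(1-3) _ _ _ \<open>i \<in> I\<close>])
    show "(\<alpha> i, \<beta> i) \<noteq> (0, 0)" if "i \<in> I" for i
      using nz[OF that] f[OF that] by auto
    show "\<alpha> i * \<beta> j \<noteq> \<alpha> j * \<beta> i" if "i \<in> I" "j \<in> I" "i \<noteq> j" for i j
      using wr[OF that] unfolding f[OF that(1)] f[OF that(2)] wronskian_combination by (auto simp: mult.commute)
    show "(\<Sum>i\<in>I. smult (c i) ((smult (\<alpha> i) p + smult (\<beta> i) q) ^ n)) = 0"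
      using rel f by simp
  qed
qed

section \<open>Normal form of the conic\<close>

text \<open>
  Let \<open>P = (p, q)\<close> be a zero of \<open>A\<close>, and complete it by a vector \<open>R = (r, s)\<close> with \<open>A(R) \<noteq> 0\<close>.  Then \<open>B(P) = 0\<close>,
  so \<open>B\<^sup>2\<close> has a double zero at \<open>P\<close>, hence so has \<open>A C\<close>.  Since \<open>C(P) \<noteq> 0\<close>, the zero of \<open>A\<close> is double.
  In the coordinates \<open>x P + y R\<close> this means \<open>A = a\<^sub>2 y\<^sup>2\<close> and \<open>B = y (b\<^sub>1 x + b\<^sub>2 y)\<close>, so
  \<open>C = -(b\<^sub>1 x + b\<^sub>2 y)\<^sup>2 / (2 a\<^sub>2)\<close>.  The change of variables makes \<open>\<surd>a\<^sub>2 y\<close> and \<open>(b\<^sub>1 x + b\<^sub>2 y) / (\<surd>-2 \<surd>a\<^sub>2)\<close> the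
  new coordinates.
\<close>

lemma conic_parametrisation:
  assumes deg: "degree A \<le> 2"
    and A: "A \<noteq> 0"
    and indep: "\<And>x y. quad A x y = 0 \<Longrightarrow> quad B x y = 0 \<Longrightarrow> quad C x y = 0 \<Longrightarrow> x = 0 \<and> y = 0"
    and rel: "\<And>x y. (quad B x y)\<^sup>2 + 2 * quad A x y * quad C x y = 0"
  obtains \<alpha> \<beta> \<gamma> \<delta> where "\<alpha> * \<delta> - \<beta> * \<gamma> \<noteq> 0"
    "\<And>x y. quad A (\<alpha> * x + \<beta> * y) (\<gamma> * x + \<delta> * y) = x\<^sup>2"
    "\<And>x y. quad B (\<alpha> * x + \<beta> * y) (\<gamma> * x + \<delta> * y) = csqrt (-2) * x * y"
    "\<And>x y. quad C (\<alpha> * x + \<beta> * y) (\<gamma> * x + \<delta> * y) = y\<^sup>2"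
proof -
  obtain v1 v2 w1 w2 where vw: "v1 * w1 = coeff A 0" "v1 * w2 + v2 * w1 = coeff A 1" "v2 * w2 = coeff A 2"
    by (rule binary_quadratic_splits)
  have Afac: "quad A x y = (v1 * x + v2 * y) * (w1 * x + w2 * y)" for x y
    unfolding quad_def vw[symmetric] by (simp add: power2_eq_square algebra_simps)
  have "(v1, v2) \<noteq> (0, 0)"
  proof
    assume "(v1, v2) = (0, 0)"
    with vw have "coeff A 0 = 0" "coeff A 1 = 0" "coeff A 2 = 0" by auto
    with degree_le_2_eq[OF deg] A show False by simp
  qed
  define p q where "p = v2" and "q = - v1"
  have AP: "quad A p q = 0" by (simp add: Afac p_def q_def)
  have P: "p \<noteq> 0 \<or> q \<noteq> 0" using \<open>(v1, v2) \<noteq> (0, 0)\<close> by (auto simp: p_def q_def)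
  have "\<exists>r s. quad A r s \<noteq> 0"
  proof (rule ccontr)
    assume "\<not> ?thesis"
    then have "quad A 1 0 = 0" "quad A 0 1 = 0" "quad A 1 1 = 0" by auto
    then have "coeff A 0 = 0" "coeff A 1 = 0" "coeff A 2 = 0" by (simp_all add: quad_def)
    with degree_le_2_eq[OF deg] A show False by simp
  qed
  then obtain r s where AR: "quad A r s \<noteq> 0" by blast
  have dpr: "r * q - p * s \<noteq> 0"
  proof
    assume 0: "r * q - p * s = 0"
    have "p\<^sup>2 * quad A r s = r\<^sup>2 * quad A p q" "q\<^sup>2 * quad A r s = s\<^sup>2 * quad A p q"
      using 0 unfolding quad_def by algebra+
    with AP AR P show False by auto
  qed
  have "quad B p q = 0" using rel[of p q] AP by simp
  with indep[OF AP] P have CP: "quad C p q \<noteq> 0" by blast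
  define polar where "polar f = 2 * coeff f 0 * p * r + coeff f 1 * (p * s + q * r) + 2 * coeff f 2 * q * s" for f
  have line: "quad f (x * p + y * r) (x * q + y * s) = quad f p q * x\<^sup>2 + polar f * x * y + quad f r s * y\<^sup>2" for f x y
    by (simp add: quad_def polar_def power2_eq_square algebra_simps)
  define a1 a2 b1 b2 c0 c1 c2 where "a1 = polar A" and "a2 = quad A r s" and "b1 = polar B" and "b2 = quad B r s"
    and "c0 = quad C p q" and "c1 = polar C" and "c2 = quad C r s"
  have Aline: "quad A (x * p + y * r) (x * q + y * s) = a1 * x * y + a2 * y\<^sup>2"
    and Bline: "quad B (x * p + y * r) (x * q + y * s) = b1 * x * y + b2 * y\<^sup>2"
    and Cline: "quad C (x * p + y * r) (x * q + y * s) = c0 * x\<^sup>2 + c1 * x * y + c2 * y\<^sup>2" for x y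
    unfolding line a1_def a2_def b1_def b2_def c0_def c1_def c2_def by (simp_all add: AP \<open>quad B p q = 0\<close>)
  have "poly [:b2\<^sup>2 + 2 * (a2 * c2), 2 * (b1 * b2) + 2 * (a1 * c2 + a2 * c1), b1\<^sup>2 + 2 * (a1 * c1 + a2 * c0), 2 * (a1 * c0):] x = 0" for x
    using rel[of "x * p + 1 * r" "x * q + 1 * s"]
    unfolding Aline Bline Cline by (simp add: power2_eq_square algebra_simps)
  then have "[:b2\<^sup>2 + 2 * (a2 * c2), 2 * (b1 * b2) + 2 * (a1 * c2 + a2 * c1), b1\<^sup>2 + 2 * (a1 * c1 + a2 * c0), 2 * (a1 * c0):] = 0"
    using poly_all_0_iff_0 by blast
  then have co: "b2\<^sup>2 + 2 * (a2 * c2) = 0" "2 * (b1 * b2) + 2 * (a1 * c2 + a2 * c1) = 0"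
      "b1\<^sup>2 + 2 * (a1 * c1 + a2 * c0) = 0" "2 * (a1 * c0) = 0"
    by simp_all
  have c0: "c0 \<noteq> 0" and a2: "a2 \<noteq> 0" using CP AR by (simp_all add: c0_def a2_def)
  have a1: "a1 = 0" using co(4) c0 by simp
  have b1: "b1 \<noteq> 0" using co(3) a2 c0 by (auto simp: a1)
  define \<omega> \<tau> where "\<omega> = csqrt a2" and "\<tau> = csqrt (-2)"
  have \<omega>: "\<omega>\<^sup>2 = a2" "\<omega> \<noteq> 0" using a2 by (auto simp: \<omega>_def)
  have "\<tau>\<^sup>2 = -2" unfolding \<tau>_def by (rule power2_csqrt)
  then have \<tau>: "\<tau>\<^sup>2 = -2" "\<tau> \<noteq> 0" by auto
  \<comment> \<open>The inverse of the change of coordinates: old coordinates in terms of new ones.\<close>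
  define X Y where "X x y = (\<tau> * \<omega> * y - b2 * x / \<omega>) / b1" and "Y x y = x / \<omega>" for x y :: complex
  have Yx: "\<omega> * Y x y = x" and Xy: "b1 * X x y + b2 * Y x y = \<tau> * \<omega> * y" for x y
    using \<omega> b1 by (simp_all add: X_def Y_def)
  have YA: "a2 * (Y x y)\<^sup>2 = x\<^sup>2" for x y
    using \<omega> a2 by (simp add: Y_def power_divide)
  have YB: "b1 * X x y * Y x y + b2 * (Y x y)\<^sup>2 = \<tau> * x * y" for x y
  proof -
    have "b1 * X x y * Y x y + b2 * (Y x y)\<^sup>2 = (b1 * X x y + b2 * Y x y) * Y x y"
      by (simp add: power2_eq_square algebra_simps)
    also have "\<dots> = \<tau> * (\<omega> * Y x y) * y" unfolding Xy by simp
    finally show ?thesis unfolding Yx .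
  qed
  have YC: "c0 * (X x y)\<^sup>2 + c1 * X x y * Y x y + c2 * (Y x y)\<^sup>2 = y\<^sup>2" for x y
  proof -
    have "2 * a2 * (c0 * (X x y)\<^sup>2 + c1 * X x y * Y x y + c2 * (Y x y)\<^sup>2) = - (b1 * X x y + b2 * Y x y)\<^sup>2"
      using co unfolding a1 by algebra
    also have "\<dots> = 2 * a2 * y\<^sup>2"
      unfolding Xy power_mult_distrib \<tau> \<omega> by simp
    finally show ?thesis using a2 by simp
  qed
  define \<alpha> \<beta> \<gamma> \<delta> where "\<alpha> = (r - b2 / b1 * p) / \<omega>" and "\<beta> = \<tau> * \<omega> / b1 * p"
    and "\<gamma> = (s - b2 / b1 * q) / \<omega>" and "\<delta> = \<tau> * \<omega> / b1 * q"
  have sub: "\<alpha> * x + \<beta> * y = X x y * p + Y x y * r" "\<gamma> * x + \<delta> * y = X x y * q + Y x y * s" for x y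
    using b1 \<omega>(2) by (simp_all add: \<alpha>_def \<beta>_def \<gamma>_def \<delta>_def X_def Y_def field_simps)
  have "\<alpha> * \<delta> - \<beta> * \<gamma> = \<tau> / b1 * (r * q - p * s)"
    using b1 \<omega>(2) by (simp add: \<alpha>_def \<beta>_def \<gamma>_def \<delta>_def field_simps)
  then show thesis
    using dpr b1 \<tau>(2) by (intro that[of \<alpha> \<delta> \<beta> \<gamma>]; simp only: sub Aline Bline Cline a1 YA YB YC \<tau>_def; simp)
qed

text \<open>
  The identity passes from the polynomials to the forms, including the point \<open>x = 0\<close> at infinity,
  because for fixed \<open>y\<close> the value of the forms is itself a polynomial in \<open>x\<close>.
\<close>

lemma sum_squares_homogeneous:
  assumes deg: "\<And>i. i < 4 \<Longrightarrow> degree (f i) \<le> 2"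
    and sq: "(\<Sum>i<4::nat. (f i)\<^sup>2) = 0"
  shows "(\<Sum>i<4. (quad (f i) x y)\<^sup>2) = 0"
proof -
  define g where "g i = [:coeff (f i) 2 * y\<^sup>2, coeff (f i) 1 * y, coeff (f i) 0:]" for i
  have g: "poly (g i) x = quad (f i) x y" for i x
    by (simp add: g_def quad_def power2_eq_square algebra_simps)
  have "poly ([:0, 1:] * (\<Sum>i<4. (g i)\<^sup>2)) x = 0" for x
  proof (cases "x = 0")
    case False
    have "(poly (g i) x)\<^sup>2 = x ^ 4 * (poly (f i) (y / x))\<^sup>2" if "i < 4" for i
    proof -
      have "poly (g i) x = x\<^sup>2 * poly (f i) (y / x)"
        using False unfolding poly_eq_quad[OF deg[OF that]] g
        by (simp add: quad_def field_simps power2_eq_square)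
      then show ?thesis by (simp add: power_mult_distrib flip: power_mult)
    qed
    then have "poly (\<Sum>i<4. (g i)\<^sup>2) x = x ^ 4 * poly (\<Sum>i<4. (f i)\<^sup>2) (y / x)"
      by (simp add: poly_sum sum_distrib_left)
    then show ?thesis by (simp add: sq)
  qed simp
  then have "[:0, 1:] * (\<Sum>i<4. (g i)\<^sup>2) = 0"
    using poly_all_0_iff_0 by blast
  then have "(\<Sum>i<4. (g i)\<^sup>2) = 0" by simp
  then have "poly (\<Sum>i<4. (g i)\<^sup>2) x = 0" by simp
  then show ?thesis by (simp add: poly_sum g)
qed

text \<open>
  \<open>A\<close>, \<open>B\<close> and \<open>C\<close> are discrete Fourier coefficients of \<open>k \<mapsto> (-1)\<^sup>k f\<^sub>k\<close>; the fourth one, belonging to the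
  character \<open>(-1)\<^sup>k\<close>, is \<open>\<Sum> f\<^sub>k / 4 = 0\<close>.  By orthogonality of
  the characters, \<open>\<Sum> f\<^sub>k\<^sup>2 = 4 (B\<^sup>2 + 2 A C)\<close>.
\<close>

lemma four_quadrics_normal_form:
  fixes f :: "nat \<Rightarrow> complex poly"
  assumes deg: "\<And>i. i < 4 \<Longrightarrow> degree (f i) \<le> 2"
    and det: "det3 (f 0) (f 1) (f 2) \<noteq> 0"
    and lin: "(\<Sum>i<4. f i) = 0"
    and sq: "(\<Sum>i<4. (f i)\<^sup>2) = 0"
  obtains \<alpha> \<beta> \<gamma> \<delta> where "\<alpha> * \<delta> - \<beta> * \<gamma> \<noteq> 0"
    "\<And>k x y. k < 4 \<Longrightarrow> quad (f k) (\<alpha> * x + \<beta> * y) (\<gamma> * x + \<delta> * y)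
       = (-1) ^ k * (\<i> ^ k * x\<^sup>2 + csqrt (-2) * x * y + (- \<i>) ^ k * y\<^sup>2)"
proof -
  define A where "A = smult (1/4) (f 0) + smult (\<i>/4) (f 1) + smult (-1/4) (f 2) + smult (-\<i>/4) (f 3)"
  define B where "B = smult (1/4) (f 0) + smult (-1/4) (f 1) + smult (1/4) (f 2) + smult (-1/4) (f 3)"
  define C where "C = smult (1/4) (f 0) + smult (-\<i>/4) (f 1) + smult (-1/4) (f 2) + smult (\<i>/4) (f 3)"
  have degA: "degree A \<le> 2"
    unfolding A_def by (intro degree_add_le order.trans[OF degree_smult_le] deg; simp)
  have f3: "f 3 = - (f 0 + f 1 + f 2)"
    using lin unfolding sum_lessThan_4 by (simp only: eq_neg_iff_add_eq_0 add.commute)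
  have q3: "quad (f 3) x y = - quad (f 0) x y - quad (f 1) x y - quad (f 2) x y" for x y
    unfolding f3 by (simp add: quad_def algebra_simps)
  have ABC: "quad (f 0) x y = quad A x y + quad B x y + quad C x y"
     "quad (f 1) x y = - (\<i> * quad A x y + quad B x y - \<i> * quad C x y)"
     "quad (f 2) x y = - quad A x y + quad B x y - quad C x y"
     "quad (f 3) x y = - (- \<i> * quad A x y + quad B x y + \<i> * quad C x y)" for x y
    unfolding A_def B_def C_def quad_add quad_smult q3
    by (simp_all add: algebra_simps add_divide_distrib diff_divide_distrib flip: add_divide_distrib diff_divide_distrib)
  have "A \<noteq> 0"
  proof
    assume "A = 0"
    have c: "(1 + \<i>) * coeff (f 0) n + (2 * \<i>) * coeff (f 1) n + (\<i> - 1) * coeff (f 2) n = 0" for n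
    proof -
      have "(1 + \<i>) * coeff (f 0) n + (2 * \<i>) * coeff (f 1) n + (\<i> - 1) * coeff (f 2) n = 4 * coeff A n"
        unfolding A_def f3 by (simp add: field_simps)
      then show ?thesis by (simp add: \<open>A = 0\<close>)
    qed
    \<comment> \<open>\<open>A = 0\<close> is a nontrivial linear relation between \<open>f 0\<close>, \<open>f 1\<close> and \<open>f 2\<close>.\<close>
    have "(1 + \<i>) * det3 (f 0) (f 1) (f 2) = 0"
      using c[of 0] c[of 1] c[of 2] unfolding det3_def by algebra
    with det show False by (simp add: complex_eq_iff)
  qed
  have indep: "x = 0 \<and> y = 0" if "quad A x y = 0" "quad B x y = 0" "quad C x y = 0" for x y
  proof -
    have "quad (f 0) x y = 0" "quad (f 1) x y = 0" "quad (f 2) x y = 0"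
      unfolding ABC that by simp_all
    then have "coeff g 0 * x\<^sup>2 + coeff g 1 * (x * y) + coeff g 2 * y\<^sup>2 = 0" if "g \<in> {f 0, f 1, f 2}" for g
      using that by (auto simp: quad_def mult.assoc)
    from det3_kernel[OF det this] show ?thesis by simp
  qed
  have rel: "(quad B x y)\<^sup>2 + 2 * quad A x y * quad C x y = 0" for x y
  proof -
    have "(\<Sum>i<4. (quad (f i) x y)\<^sup>2) = 4 * ((quad B x y)\<^sup>2 + 2 * quad A x y * quad C x y)"
      unfolding sum_lessThan_4 ABC by (simp add: power2_eq_square algebra_simps)
    moreover have "(\<Sum>i<4. (quad (f i) x y)\<^sup>2) = 0"
      by (rule sum_squares_homogeneous[OF deg sq])
    ultimately show ?thesis by (metis mult_eq_0_iff zero_neq_numeral)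
  qed
  show thesis
  proof (rule conic_parametrisation[OF degA \<open>A \<noteq> 0\<close> indep rel])
    fix \<alpha> \<beta> \<gamma> \<delta>
    assume M: "\<alpha> * \<delta> - \<beta> * \<gamma> \<noteq> 0"
      "\<And>x y. quad A (\<alpha> * x + \<beta> * y) (\<gamma> * x + \<delta> * y) = x\<^sup>2"
      "\<And>x y. quad B (\<alpha> * x + \<beta> * y) (\<gamma> * x + \<delta> * y) = csqrt (-2) * x * y"
      "\<And>x y. quad C (\<alpha> * x + \<beta> * y) (\<gamma> * x + \<delta> * y) = y\<^sup>2"
    show thesis
    proof (rule that[OF M(1)])
      fix k :: nat and x y :: complex
      assume "k < 4"
      then have "k = 0 \<or> k = 1 \<or> k = 2 \<or> k = 3" by auto
      then show "quad (f k) (\<alpha> * x + \<beta> * y) (\<gamma> * x + \<delta> * y)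
         = (-1) ^ k * (\<i> ^ k * x\<^sup>2 + csqrt (-2) * x * y + (- \<i>) ^ k * y\<^sup>2)"
        by (elim disjE; hypsubst; simp only: ABC M; simp add: power3_eq_cube)
    qed
  qed
qed

section \<open>Four quadratics with dependent fifth powers\<close>

text \<open>
  The theorem for coefficient vectors: any three of the quadratics are independent and no \<open>c i\<close>
  vanishes, so the quadratics can be rescaled to \<open>f i\<close> with sum zero.  Equality of the new
  coefficients \<open>l i\<close> then makes the sum of the squares vanish.
\<close>

lemma quintic_relation_normal_form:
  fixes p :: "nat \<Rightarrow> complex poly" and c :: "nat \<Rightarrow> complex"
  assumes deg: "\<And>i. i < 4 \<Longrightarrow> degree (p i) \<le> 2"
    and wr: "\<And>i j. i < 4 \<Longrightarrow> j < 4 \<Longrightarrow> i \<noteq> j \<Longrightarrow> wronskian (p i) (p j) \<noteq> 0"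
    and rel: "\<And>x y. (\<Sum>i<4. c i * quad (p i) x y ^ 5) = 0"
    and nontrivial: "i0 < 4" "c i0 \<noteq> 0"
  shows "\<exists>\<kappa> \<alpha> \<beta> \<gamma> \<delta>. \<alpha> * \<delta> - \<beta> * \<gamma> \<noteq> 0 \<and> (\<forall>k<4. \<kappa> k \<noteq> 0 \<and>
    (\<forall>x y. \<kappa> k * quad (p k) (\<alpha> * x + \<beta> * y) (\<gamma> * x + \<delta> * y)
       = \<i> ^ k * x\<^sup>2 + csqrt (-2) * x * y + (- \<i>) ^ k * y\<^sup>2))"
proof -
  have polyrel: "(\<Sum>i<4. smult (c i) (p i ^ 5)) = 0"
  proof -
    have "poly (\<Sum>i<4. smult (c i) (p i ^ 5)) t = 0" for t
      using rel[of 1 t] deg by (simp add: poly_sum poly_eq_quad)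
    then show ?thesis using poly_all_0_iff_0 by blast
  qed
  have nz: "p i \<noteq> 0" if i: "i < 4" for i
  proof -
    have "\<exists>j<4. i \<noteq> (j::nat)" by (rule exI[of _ "if i = 0 then 1 else 0"]) simp
    then show ?thesis using wr[OF i] by (auto simp: wronskian_def)
  qed
  have det: "det3 (p i) (p j) (p k) \<noteq> 0"
    if dist: "distinct [i, j, k, m]" "set [i, j, k, m] \<subseteq> {..<4}" for i j k m
  proof
    assume det: "det3 (p i) (p j) (p k) = 0"
    have lt: "i < 4" "j < 4" "k < 4" "m < 4" and ij: "i \<noteq> j" using dist by auto
    note sum4 = sum_four_distinct[OF dist]
    have w: "wronskian (p i) (p j) \<noteq> 0" by (rule wr[OF lt(1,2) ij])
    obtain a b where k: "p k = smult a (p i) + smult b (p j)"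
      by (rule det3_eq_0_imp_combination[OF deg[OF lt(1)] deg[OF lt(2)] deg[OF lt(3)] w det])
    have span: "\<exists>a b. p n = smult a (p i) + smult b (p j)" if "n \<in> {i, j, k}" for n
    proof -
      have "p i = smult 1 (p i) + smult 0 (p j)" "p j = smult 0 (p i) + smult 1 (p j)" by simp_all
      with k that show ?thesis by blast
    qed
    have "c n = 0" if "n < 4" for n
    proof (cases "det3 (p i) (p j) (p m) = 0")
      case True
      obtain a b where m: "p m = smult a (p i) + smult b (p j)"
        by (rule det3_eq_0_imp_combination[OF deg[OF lt(1)] deg[OF lt(2)] deg[OF lt(4)] w True])
      have span4: "\<exists>a b. p n = smult a (p i) + smult b (p j)" if "n \<in> {..<4}" for n
        using that span m unfolding sum4(2) by blast
      show ?thesis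
        by (rule powers_in_pencil_independent[OF w finite_lessThan _ span4 _ _ polyrel])
           (use nz wr that in simp_all)
    next
      case False
      have "c m * quad (p m) x y ^ 5 + c i * quad (p i) x y ^ 5 + c j * quad (p j) x y ^ 5 + c k * quad (p k) x y ^ 5 = 0" for x y
        using rel[of x y] unfolding sum4(1) by (simp only: add_ac)
      then have cm: "c m = 0"
        by (rule outside_pencil_coefficient_zero[OF False k])
      have sum3: "(\<Sum>n\<in>{i, j, k}. smult (c n) (p n ^ 5)) = 0"
        using polyrel dist(1) unfolding sum4(1) by (simp add: cm add.assoc)
      have "c n = 0" if "n \<in> {i, j, k}" for n
        by (rule powers_in_pencil_independent[OF w _ _ span _ _ sum3 that])
           (use nz wr lt dist(1) in auto)
      with cm that sum4(2) show ?thesis by blast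
    qed
    with nontrivial show False by blast
  qed
  \<comment> \<open>The signed minors, that is, the coefficients of the linear relation.\<close>
  define d where "d = (!) [det3 (p 1) (p 2) (p 3), - det3 (p 0) (p 2) (p 3), det3 (p 0) (p 1) (p 3), - det3 (p 0) (p 1) (p 2)]"
  have d_nz: "d n \<noteq> 0" if "n < 4" for n
  proof -
    have "n = 0 \<or> n = 1 \<or> n = 2 \<or> n = 3" using that by auto
    then show ?thesis
    proof (elim disjE)
      show "d n \<noteq> 0" if "n = 0" using det[of 1 2 3 0] that by (simp add: d_def)
      show "d n \<noteq> 0" if "n = 1" using det[of 0 2 3 1] that by (simp add: d_def)
      show "d n \<noteq> 0" if "n = 2" using det[of 0 1 3 2] that by (simp add: d_def)
      show "d n \<noteq> 0" if "n = 3" using det[of 0 1 2 3] that by (simp add: d_def)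
    qed
  qed
  have c_nz: "c n \<noteq> 0" if "n < 4" for n
  proof
    assume cn: "c n = 0"
    have "card ({..<4} - {n}) = 3" using that by (subst card_Diff_subset) auto
    then obtain i j k where ijk: "{..<4} - {n} = {i, j, k}" "i \<noteq> j" "j \<noteq> k" "i \<noteq> k"
      unfolding card_3_iff by metis
    have "i \<in> {..<4} - {n}" "j \<in> {..<4} - {n}" "k \<in> {..<4} - {n}" unfolding ijk(1) by simp_all
    then have dist: "distinct [i, j, k, n]" "set [i, j, k, n] \<subseteq> {..<4}" using ijk(2-4) that by auto
    have "smult (c i) (p i ^ 5) + smult (c j) (p j ^ 5) + smult (c k) (p k ^ 5) = 0"
      using polyrel unfolding sum_four_distinct(1)[OF dist] by (simp add: cn)
    moreover have lt: "i < 4" "j < 4" "k < 4" using dist(2) by auto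
    ultimately have "c i = 0 \<and> c j = 0 \<and> c k = 0"
      by (intro three_independent_quadratics_fermat[OF deg[OF lt(1)] deg[OF lt(2)] deg[OF lt(3)] det[OF dist]])
    moreover have "i0 \<in> {i, j, k, n}"
      using nontrivial(1) unfolding sum_four_distinct(2)[OF dist, symmetric] by simp
    ultimately show False using cn nontrivial(2) by auto
  qed
  define f where "f i = smult (d i) (p i)" for i
  define l where "l i = c i / d i ^ 5" for i
  have fdeg: "degree (f i) \<le> 2" if "i < 4" for i
    unfolding f_def by (intro order.trans[OF degree_smult_le] deg that)
  have flin: "(\<Sum>i<4. f i) = 0"
  proof -
    have d: "d 0 = det3 (p 1) (p 2) (p 3)" "d 1 = - det3 (p 0) (p 2) (p 3)"
      "d 2 = det3 (p 0) (p 1) (p 3)" "d 3 = - det3 (p 0) (p 1) (p 2)"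
      by (simp_all add: d_def)
    have "smult (det3 (p 1) (p 2) (p 3)) (p 0) - smult (det3 (p 0) (p 2) (p 3)) (p 1)
        + smult (det3 (p 0) (p 1) (p 3)) (p 2) - smult (det3 (p 0) (p 1) (p 2)) (p 3) = 0"
      by (rule det3_relation; rule deg; simp)
    then show ?thesis
      unfolding sum_lessThan_4 f_def d smult_minus_left by (simp only: diff_conv_add_uminus)
  qed
  have fquint: "(\<Sum>i<4. smult (l i) (f i ^ 5)) = 0"
  proof -
    have "smult (l i) (f i ^ 5) = smult (c i) (p i ^ 5)" if "i < 4" for i
      using d_nz[OF that] by (simp add: l_def f_def smult_power)
    then show ?thesis using polyrel by simp
  qed
  have fwr: "wronskian (f i) (f j) \<noteq> 0" if "i < 4" "j < 4" "i \<noteq> j" for i j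
  proof -
    have "wronskian (f i) (f j) = smult (d i * d j) (wronskian (p i) (p j))"
      using wronskian_combination[of "d i" "p i" 0 "p j" 0 "d j"] by (simp add: f_def)
    then show ?thesis using wr[OF that] d_nz that(1,2) by simp
  qed
  have fdet: "det3 (f 0) (f 1) (f 2) \<noteq> 0"
  proof -
    have "det3 (f 0) (f 1) (f 2) = d 0 * d 1 * d 2 * det3 (p 0) (p 1) (p 2)"
      by (simp add: det3_def f_def algebra_simps)
    then show ?thesis using d_nz[of 0] d_nz[of 1] d_nz[of 2] det[of 0 1 2 3] by simp
  qed
  have l_nz: "l i \<noteq> 0" if "i < 4" for i
    using c_nz[OF that] d_nz[OF that] by (simp add: l_def)
  have l_eq: "l i = l 0" if "i < 4" for i
    by (rule coefficients_equal[OF fdeg fwr fdet l_nz flin fquint that]) simp_all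
  have "smult (l 0) (\<Sum>i<4. f i ^ 5) = (\<Sum>i<4. smult (l i) (f i ^ 5))"
    unfolding smult_sum_right using l_eq by (intro sum.cong refl arg_cong2[of _ _ _ _ smult]) (metis lessThan_iff)
  then have "smult (l 0) (\<Sum>i<4. f i ^ 5) = 0"
    by (simp only: fquint)
  then have f5: "(\<Sum>i<4. f i ^ 5) = 0" using l_nz[of 0] by simp
  have f3: "f 3 = - (f 0 + f 1 + f 2)"
    using flin unfolding sum_lessThan_4 by (simp only: eq_neg_iff_add_eq_0 add.commute)
  have "f 0 ^ 5 + f 1 ^ 5 + f 2 ^ 5 - (f 0 + f 1 + f 2) ^ 5 = 0"
    using f5 power_minus_odd[of 5 "f 0 + f 1 + f 2"]
    unfolding sum_lessThan_4 f3 by (simp only: odd_numeral diff_conv_add_uminus simp_thms)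
  moreover have "f i + f j \<noteq> 0" if "i < 4" "j < 4" "i \<noteq> j" for i j
  proof
    assume "f i + f j = 0"
    then have "f j = - f i" by (simp add: eq_neg_iff_add_eq_0 add.commute)
    with fwr[OF that] show False by (simp add: wronskian_def pderiv_minus)
  qed
  ultimately have e: "(f 0)\<^sup>2 + (f 1)\<^sup>2 + (f 2)\<^sup>2 + f 0 * f 1 + f 1 * f 2 + f 2 * f 0 = 0"
    unfolding quintic_power_sum_factorisation by simp
  have "(\<Sum>i<4. (f i)\<^sup>2) = 2 * ((f 0)\<^sup>2 + (f 1)\<^sup>2 + (f 2)\<^sup>2 + f 0 * f 1 + f 1 * f 2 + f 2 * f 0)"
    unfolding sum_lessThan_4 f3 by (simp add: power2_eq_square algebra_simps)
  then have f2: "(\<Sum>i<4. (f i)\<^sup>2) = 0" unfolding e by simp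
  show ?thesis
  proof (rule four_quadrics_normal_form[OF fdeg fdet flin f2])
    fix \<alpha> \<beta> \<gamma> \<delta>
    assume det_M: "\<alpha> * \<delta> - \<beta> * \<gamma> \<noteq> 0"
      and M: "\<And>k x y. k < 4 \<Longrightarrow> quad (f k) (\<alpha> * x + \<beta> * y) (\<gamma> * x + \<delta> * y)
         = (-1) ^ k * (\<i> ^ k * x\<^sup>2 + csqrt (-2) * x * y + (- \<i>) ^ k * y\<^sup>2)"
    have *: "(- 1) ^ k * d k * quad (p k) (\<alpha> * x + \<beta> * y) (\<gamma> * x + \<delta> * y)
         = \<i> ^ k * x\<^sup>2 + csqrt (-2) * x * y + (- \<i>) ^ k * y\<^sup>2" if "k < 4" for k x y
    proof -
      have "(- 1) ^ k * d k * quad (p k) (\<alpha> * x + \<beta> * y) (\<gamma> * x + \<delta> * y)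
          = (-1) ^ k * quad (f k) (\<alpha> * x + \<beta> * y) (\<gamma> * x + \<delta> * y)"
        by (simp only: f_def quad_smult mult.assoc)
      also have "\<dots> = ((-1) ^ k * (-1) ^ k) * (\<i> ^ k * x\<^sup>2 + csqrt (-2) * x * y + (- \<i>) ^ k * y\<^sup>2)"
        unfolding M[OF that] by (simp only: mult.assoc)
      finally show ?thesis by (simp flip: power_mult_distrib)
    qed
    show ?thesis
      by (rule exI[of _ "\<lambda>k. (- 1) ^ k * d k"], intro exI conjI allI impI, rule det_M)
         (simp_all only: *, simp add: d_nz)
  qed
qed

section \<open>Binary forms as bivariate polynomials\<close>

definition eval2 :: "bipoly \<Rightarrow> complex \<Rightarrow> complex \<Rightarrow> complex" where
  "eval2 f x y = poly (poly f [:y:]) x"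

lemma eval2_simps [simp]:
  "eval2 0 x y = 0"
  "eval2 (f + g) x y = eval2 f x y + eval2 g x y"
  "eval2 (f - g) x y = eval2 f x y - eval2 g x y"
  "eval2 (f * g) x y = eval2 f x y * eval2 g x y"
  "eval2 (f ^ n) x y = eval2 f x y ^ n"
  "eval2 (cscale c f) x y = c * eval2 f x y"
  "eval2 (sum h I) x y = (\<Sum>i\<in>I. eval2 (h i) x y)"
  "eval2 var_x x y = x" "eval2 var_y x y = y"
  by (simp_all add: eval2_def cscale_def poly_sum var_x_def var_y_def)

text \<open>
  For fixed \<open>y\<close> the values determine the polynomial \<open>f(\<cdot>, y)\<close>, and the constants \<open>[:y:]\<close> are infinitely
  many points of the coefficient ring, so they determine \<open>f\<close>.
\<close>

lemma eval2_inject: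
  assumes "\<And>x y. eval2 f x y = eval2 g x y"
  shows "f = g"
proof -
  have "poly (f - g) [:y:] = 0" for y
    using assms by (simp add: eval2_def poly_eq_poly_eq_iff[symmetric] fun_eq_iff)
  then have "range (\<lambda>y. [:y:]) \<subseteq> {z. poly (f - g) z = 0}" by auto
  moreover have "infinite (range (\<lambda>y::complex. [:y:]))"
    using finite_imageD[of "\<lambda>y::complex. [:y:]" UNIV] by (auto simp: inj_def infinite_UNIV_char_0)
  ultimately have "infinite {z. poly (f - g) z = 0}"
    using finite_subset by blast
  then show ?thesis using poly_roots_finite[of "f - g"] by auto
qed

lemma eval2_substitute: "eval2 (substitute f u v) x y = eval2 f (eval2 u x y) (eval2 v x y)"
proof -
  have "eval2 f X Y = (\<Sum>j\<le>degree f. poly (coeff f j) X * Y ^ j)" for X Y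
    by (simp add: eval2_def poly_altdef[of f] poly_sum poly_power)
  also have "(\<Sum>j\<le>degree f. poly (coeff f j) X * Y ^ j)
      = (\<Sum>j\<le>degree f. \<Sum>i\<le>degree (coeff f j). coeff (coeff f j) i * (X ^ i * Y ^ j))" for X Y
    unfolding poly_altdef[of "coeff f _" X] sum_distrib_right by (simp only: mult.assoc)
  finally show ?thesis
    unfolding substitute_def eval2_simps by simp
qed

lemma eval2_linear_change:
  "eval2 (linear_change f M) x y = eval2 f (M $ 1 $ 1 * x + M $ 1 $ 2 * y) (M $ 2 $ 1 * x + M $ 2 $ 2 * y)"
  by (simp add: linear_change_def eval2_substitute)

definition dehomogenise :: "bipoly \<Rightarrow> complex poly" where
  "dehomogenise f = [:coeff (coeff f 0) 2, coeff (coeff f 1) 1, coeff (coeff f 2) 0:]"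

lemma degree_dehomogenise: "degree (dehomogenise f) \<le> 2"
  by (simp add: dehomogenise_def)

lemma eval2_quad:
  assumes "binary_form 2 f"
  shows "eval2 f x y = quad (dehomogenise f) x y"
proof -
  have z: "coeff (coeff f j) i = 0" if "i + j \<noteq> 2" for i j
    using assms that by (auto simp: binary_form_def)
  have "f = [:monom (coeff (coeff f 0) 2) 2, monom (coeff (coeff f 1) 1) 1, [:coeff (coeff f 2) 0:]:]"
  proof (intro poly_eqI)
    fix j i
    consider "j = 0" | "j = 1" | "j = 2" | m where "j = Suc (Suc (Suc m))"
      by (metis One_nat_def Suc_1 not0_implies_Suc)
    then show "coeff (coeff f j) i = coeff (coeff [:monom (coeff (coeff f 0) 2) 2, monom (coeff (coeff f 1) 1) 1, [:coeff (coeff f 2) 0:]:] j) i"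
      by cases (auto simp: numeral_2_eq_2 coeff_pCons z split: nat.splits)
  qed
  then have "eval2 f x y = eval2 [:monom (coeff (coeff f 0) 2) 2, monom (coeff (coeff f 1) 1) 1, [:coeff (coeff f 2) 0:]:] x y"
    by (rule arg_cong)
  also have "\<dots> = quad (dehomogenise f) x y"
    by (simp add: eval2_def quad_def dehomogenise_def poly_monom numeral_2_eq_2 algebra_simps)
  finally show ?thesis .
qed

lemma wronskian_zero_imp_proportional:
  assumes "binary_form 2 f" "binary_form 2 g" "f \<noteq> 0" "g \<noteq> 0"
    and "wronskian (dehomogenise f) (dehomogenise g) = 0"
  shows "proportional f g"
proof -
  obtain a b c where F: "dehomogenise f = [:a, b, c:]" unfolding dehomogenise_def by blast
  obtain a' b' c' where G: "dehomogenise g = [:a', b', c':]" unfolding dehomogenise_def by blast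
  have nz: "dehomogenise h \<noteq> 0" if "binary_form 2 h" "h \<noteq> 0" for h
  proof
    assume "dehomogenise h = 0"
    then have "eval2 h x y = eval2 0 x y" for x y
      using eval2_quad[OF that(1)] by (simp add: quad_def)
    then have "h = 0" by (rule eval2_inject)
    with that(2) show False by simp
  qed
  have m: "a * b' = a' * b" "a * c' = a' * c" "b * c' = b' * c"
    using assms(5) unfolding F G wronskian_quadratic by auto
  have nf: "a \<noteq> 0 \<or> b \<noteq> 0 \<or> c \<noteq> 0" and ng: "a' \<noteq> 0 \<or> b' \<noteq> 0 \<or> c' \<noteq> 0"
    using nz[OF assms(1,3)] nz[OF assms(2,4)] unfolding F G by auto
  have "\<exists>k. a = k * a' \<and> b = k * b' \<and> c = k * c'"
    using ng
  proof (elim disjE)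
    assume "a' \<noteq> 0" then show ?thesis using m by (intro exI[of _ "a / a'"]) (simp add: field_simps)
  next
    assume "b' \<noteq> 0" then show ?thesis using m by (intro exI[of _ "b / b'"]) (simp add: field_simps)
  next
    assume "c' \<noteq> 0" then show ?thesis using m by (intro exI[of _ "c / c'"]) (simp add: field_simps)
  qed
  then obtain k where k: "a = k * a'" "b = k * b'" "c = k * c'" by blast
  have "eval2 f x y = eval2 (cscale k g) x y" for x y
    unfolding eval2_simps eval2_quad[OF assms(1)] eval2_quad[OF assms(2)] F G
    by (simp add: quad_def k numeral_2_eq_2 algebra_simps)
  then have "f = cscale k g" by (rule eval2_inject)
  moreover have "k \<noteq> 0" using k nf by auto
  ultimately show ?thesis unfolding proportional_def by blast
qed

lemma eval2_std_form: "eval2 (std_form k) x y = \<i> ^ k * x\<^sup>2 + csqrt (-2) * x * y + (- \<i>) ^ k * y\<^sup>2"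
proof -
  have "\<i> powi (- int k) = (- \<i>) ^ k"
    by (simp add: power_int_minus flip: power_inverse)
  then show ?thesis by (simp add: std_form_def mult.assoc)
qed

lemma std_form_inject: "inj_on std_form {0..3}"
proof (rule inj_onI)
  fix j k :: nat
  assume jk: "j \<in> {0..3}" "k \<in> {0..3}" "std_form j = std_form k"
  then have "\<i> ^ j = \<i> ^ k"
    using eval2_std_form[of j 1 0] eval2_std_form[of k 1 0] by simp
  moreover have "j = 0 \<or> j = 1 \<or> j = 2 \<or> j = 3" "k = 0 \<or> k = 1 \<or> k = 2 \<or> k = 3"
    using jk(1,2) by auto
  ultimately show "j = k"
    by (elim disjE; simp add: power3_eq_cube complex_eq_iff)
qed

text \<open>
  Otherwise \<open>f\<^sup>5 - g\<^sup>5 = 0\<close> would be a relation between powers of two independent quadratics.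
  Hence the passage from a set of forms to the set of their fifth powers loses no element.
\<close>

lemma fifth_power_injective:
  assumes "binary_form 2 f" "binary_form 2 g" "f \<noteq> 0" "g \<noteq> 0" "f ^ 5 = g ^ 5"
  shows "proportional f g"
proof (rule ccontr)
  assume "\<not> proportional f g"
  then have w: "wronskian (dehomogenise f) (dehomogenise g) \<noteq> 0"
    using wronskian_zero_imp_proportional assms by blast
  have "poly (dehomogenise f ^ 5) t = poly (dehomogenise g ^ 5) t" for t
  proof -
    have "eval2 (f ^ 5) 1 t = eval2 (g ^ 5) 1 t" by (simp only: assms(5))
    then show ?thesis
      by (simp add: eval2_quad assms(1,2) poly_eq_quad degree_dehomogenise)
  qed
  then have eq: "dehomogenise f ^ 5 = dehomogenise g ^ 5"
    by (simp add: poly_eq_poly_eq_iff[symmetric] fun_eq_iff)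
  have "(if (0::nat) = 0 then 1 else - 1) = (0::complex)"
    by (rule powers_of_combinations_independent[OF w, of "{0, 1::nat}" 5
        "\<lambda>i. if i = 0 then 1 else 0" "\<lambda>i. if i = 0 then 0 else 1" "\<lambda>i. if i = 0 then 1 else -1" 0])
       (auto simp: eq)
  then show False by simp
qed

text \<open>
  In the second part the values of the forms have the Fourier coordinates \<open>a, b, c\<close> with \<open>b\<^sup>2 = -2 a c\<close>,
  so the factorisation of the fifth power sum can be read backwards.
\<close>

theorem theorem1p7:
  shows "(\<forall>F. W2_set 4 5 F \<longrightarrow> cousins 4 F (std_form ` {0..3}))
     \<and> (\<Sum>k = 0..3. cscale ((-1) ^ k) (std_form k ^ 5)) = 0"
proof (intro conjI allI impI)
  fix F assume "W2_set 4 5 F"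
  then have F: "finite F" "card F = 4" "honest F" "\<And>f. f \<in> F \<Longrightarrow> binary_form 2 f"
    and dep: "bipoly.dependent ((\<lambda>f. f ^ 5) ` F)"
    by (auto simp: W2_set_def)
  have nz: "f \<noteq> 0" if "f \<in> F" for f using F(3) that by (auto simp: honest_def)
  have npr: "\<not> proportional f g" if "f \<in> F" "g \<in> F" "f \<noteq> g" for f g
    using F(3) that by (auto simp: honest_def pairwise_def)
  obtain e where e: "bij_betw e {..<4::nat} F"
    using F(1,2) ex_bij_betw_nat_finite[of F] by (auto simp: atLeast0LessThan)
  have eF: "e i \<in> F" if "i < 4" for i using e that by (auto simp: bij_betw_def)
  have e_inj: "e i \<noteq> e j" if "i < 4" "j < 4" "i \<noteq> j" for i j
    using e that by (auto simp: bij_betw_def inj_on_def)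
  have pow_inj: "inj_on (\<lambda>f. f ^ 5) F"
  proof (rule inj_onI)
    fix f g assume fg: "f \<in> F" "g \<in> F" "f ^ 5 = g ^ 5"
    then have "proportional f g"
      by (intro fifth_power_injective F(4) nz)
    with npr fg show "f = g" by blast
  qed
  obtain u where u: "\<exists>v\<in>(\<lambda>f. f ^ 5) ` F. u v \<noteq> 0" "(\<Sum>v\<in>(\<lambda>f. f ^ 5) ` F. cscale (u v) v) = 0"
    using dep bipoly.dependent_finite[of "(\<lambda>f. f ^ 5) ` F"] F(1) by auto
  define p where "p i = dehomogenise (e i)" for i
  define c where "c i = u (e i ^ 5)" for i
  have ev: "eval2 (e i) x y = quad (p i) x y" if "i < 4" for i x y
    unfolding p_def using F(4)[OF eF[OF that]] by (rule eval2_quad)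
  have "(\<Sum>i<4. cscale (c i) (e i ^ 5)) = 0"
    using u(2) unfolding sum.reindex[OF pow_inj] c_def
    by (simp add: sum.reindex_bij_betw[OF e, symmetric])
  then have "eval2 (\<Sum>i<4. cscale (c i) (e i ^ 5)) x y = 0" for x y by simp
  then have rel: "(\<Sum>i<4. c i * quad (p i) x y ^ 5) = 0" for x y
    by (simp add: ev)
  obtain i0 where i0: "i0 < 4" "c i0 \<noteq> 0"
    using u(1) e by (auto simp: c_def bij_betw_def)
  have wr: "wronskian (p i) (p j) \<noteq> 0" if "i < 4" "j < 4" "i \<noteq> j" for i j
  proof
    assume "wronskian (p i) (p j) = 0"
    then have "proportional (e i) (e j)"
      unfolding p_def using that by (intro wronskian_zero_imp_proportional F(4) nz eF)
    with npr[OF eF eF e_inj] that show False by blast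
  qed
  have deg: "degree (p i) \<le> 2" for i
    unfolding p_def by (rule degree_dehomogenise)
  obtain \<kappa> \<alpha> \<beta> \<gamma> \<delta> where M: "\<alpha> * \<delta> - \<beta> * \<gamma> \<noteq> 0"
    "\<forall>k<4. \<kappa> k \<noteq> 0 \<and> (\<forall>x y. \<kappa> k * quad (p k) (\<alpha> * x + \<beta> * y) (\<gamma> * x + \<delta> * y)
       = \<i> ^ k * x\<^sup>2 + csqrt (-2) * x * y + (- \<i>) ^ k * y\<^sup>2)"
    using quintic_relation_normal_form[OF deg wr rel i0] by blast
  define m :: "complex ^ 2 ^ 2" where "m = vector [vector [\<alpha>, \<beta>], vector [\<gamma>, \<delta>]]"
  have m: "m $ 1 $ 1 = \<alpha>" "m $ 1 $ 2 = \<beta>" "m $ 2 $ 1 = \<gamma>" "m $ 2 $ 2 = \<delta>"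
    by (simp_all add: m_def)
  have "invertible m"
    using M(1) by (simp add: invertible_det_nz det_2 m)
  have std: "std_form k = cscale (\<kappa> k) (linear_change (e k) m)" if "k < 4" for k
    by (rule eval2_inject)
       (use that in \<open>simp add: eval2_std_form eval2_linear_change m ev M(2)\<close>)
  have shift: "bij_betw (\<lambda>j. j - 1) {1..4::nat} {..<4}"
    by (rule bij_betw_byWitness[where f' = Suc]) auto
  show "cousins 4 F (std_form ` {0..3})"
    unfolding cousins_def
  proof (intro exI conjI ballI)
    show "bij_betw (\<lambda>j. e (j - 1)) {1..4} F"
      using bij_betw_trans[OF shift e] by (simp add: comp_def)
    have "bij_betw std_form {..<4} (std_form ` {0..3})"
    proof -
      have "{..<4::nat} = {0..3}" by auto
      then show ?thesis using std_form_inject by (simp add: bij_betw_def)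
    qed
    then show "bij_betw (\<lambda>j. std_form (j - 1)) {1..4} (std_form ` {0..3})"
      using bij_betw_trans[OF shift] by (simp add: comp_def)
    show "id permutes {1..4::nat}" by (rule permutes_id)
    show "invertible m" by fact
    show "\<kappa> (j - 1) \<noteq> 0" if "j \<in> {1..4::nat}" for j using that M(2) by auto
    show "std_form (j - 1) = cscale (\<kappa> (j - 1)) (linear_change (e (id j - 1)) m)" if "j \<in> {1..4::nat}" for j
      using that std[of "j - 1"] by auto
  qed
next
  show "(\<Sum>k = 0..3. cscale ((-1) ^ k) (std_form k ^ 5)) = 0"
  proof (rule eval2_inject)
    fix x y :: complex
    define a b c where "a = x\<^sup>2" and "b = csqrt (-2) * x * y" and "c = y\<^sup>2"
    have b: "b\<^sup>2 = - 2 * (a * c)"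
      unfolding a_def b_def c_def power_mult_distrib power2_csqrt by simp
    define f where "f = (\<lambda>k. (-1) ^ k * eval2 (std_form k) x y)"
    have f: "f 0 = a + b + c" "f 1 = - (\<i> * a + b - \<i> * c)" "f 2 = - a + b - c" "f 3 = - (- \<i> * a + b + \<i> * c)"
      unfolding f_def eval2_std_form a_def b_def c_def by (simp_all add: power3_eq_cube)
    have s: "f 0 + f 1 + f 2 = - f 3" unfolding f by simp
    have "(f 0)\<^sup>2 + (f 1)\<^sup>2 + (f 2)\<^sup>2 + f 0 * f 1 + f 1 * f 2 + f 2 * f 0 = 2 * (b\<^sup>2 + 2 * (a * c))"
      unfolding f by (simp add: power2_eq_square algebra_simps)
    also have "\<dots> = 0" unfolding b by simp
    finally have "f 0 ^ 5 + f 1 ^ 5 + f 2 ^ 5 - (f 0 + f 1 + f 2) ^ 5 = 0"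
      unfolding quintic_power_sum_factorisation by simp
    then have "f 0 ^ 5 + f 1 ^ 5 + f 2 ^ 5 + f 3 ^ 5 = 0"
      unfolding s by simp
    moreover have "{0..3::nat} = {..<4}" by auto
    ultimately show "eval2 (\<Sum>k = 0..3. cscale ((-1) ^ k) (std_form k ^ 5)) x y = eval2 0 x y"
      by (simp add: f_def sum_lessThan_4)
  qed
qed

end
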